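(* Every two-dimensional cross-ratio system $f:\mathbb{Z}^2\to\mathbb{C}$ with labelling $\alpha^1,\alpha^2$ can be extended into a unique $C^+$ lattice and a unique $C^-$ lattice. That is, under the standing assumption that the evolution stays nondegenerate (the four points of every quad of the lattices occurring are pairwise distinct), there is exactly one $C^+$ lattice and exactly one $C^-$ lattice $\hat f:\mathbb{Z}^4\to\mathbb{C}$, with labelling $\hat\alpha$, such that $\hat f(i,j,0,0)=f(i,j)$, $\hat\alpha^1(i,j,0,0)=\alpha^1(i,j)$ and $\hat\alpha^2(i,j,0,0)=\alpha^2(i,j)$ for all $i,j\in\mathbb{Z}$.
   Context: For maps on $\mathbb{Z}^n$ write $f=f(x)$, $f_i=f(x+e_i)$, $f_{ij}=f(x+e_i+e_j)$; for edge based maps $\alpha^i=\alpha^i(x)$ is the value on the edge $(x,x+e_i)$ and $\alpha^i_j=\alpha^i(x+e_j)$. A cross-ratio system is a map $f:\mathbb{Z}^n\to\mathbb{C}$ (with the four points of each quad pairwise distinct) together with an edge labelling $\alpha$ with values in $\mathbb{C}\setminus\{0\}$, i.e. $\alpha^i_j=\alpha^i$ for $i\ne j$, such that with $d^i=f_i-f$ $$\frac{d^id^i_j}{d^jd^j_i}=\frac{(\alpha^i)^2}{(\alpha^j)^2}\qquad(i\neq j).$$ Its associated vertex map $s:\mathbb{Z}^n\to\mathbb{C}$ is defined by $s(\mathbf{0})=1$ and $d^i=\alpha^is_is$. Let $D=\{(i,j,i,j):i,j\in\mathbb{Z}\}\subset\mathbb{Z}^4$ be the diagonal net. Let $f:\mathbb{Z}^4\to\mathbb{C}$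 be a cross-ratio system with labelling $\alpha$ whose map $s$ satisfies $s_1(x)\bar s_3(x)=1$ and $s_2(x)\bar s_4(x)=1$ for every $x\in D$. Then $f$ is called a $C^+$ lattice if $\alpha^1(x)\bar\alpha^3(x)=-1$ and $\alpha^2(x)\bar\alpha^4(x)=-1$ for all $x\in D$, and a $C^-$ lattice if $\alpha^1(x)=\bar\alpha^3(x)$ and $\alpha^2(x)=\bar\alpha^4(x)$ for all $x\in D$. *)

theory Defs
  imports "HOL-Analysis.Analysis"
begin

text \<open>
  The lattice \<open>\<int>\<^sup>n\<close> is \<open>int ^ 'n\<close>, with unit vectors \<open>e i\<close>. The two-dimensional and
  four-dimensional lattices are \<open>int ^ 2\<close> and \<open>int ^ 4\<close>; their index types consist of
  \<open>1, 2\<close> and of \<open>1, 2, 3, 4\<close>, respectively (the last index coincides with \<open>0\<close>).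
  An edge based map \<open>\<alpha>\<close> is given by its values \<open>\<alpha> i x\<close> on the edges \<open>(x, x + e i)\<close>.
\<close>

abbreviation e :: "'n::finite \<Rightarrow> int ^ 'n" where
  "e i \<equiv> axis i 1"

definition edge_diff :: "(int ^ 'n::finite \<Rightarrow> complex) \<Rightarrow> 'n \<Rightarrow> int ^ 'n \<Rightarrow> complex" where
  "edge_diff f i x = f (x + e i) - f x"

definition labelling :: "('n::finite \<Rightarrow> int ^ 'n \<Rightarrow> complex) \<Rightarrow> bool" where
  "labelling \<alpha> \<longleftrightarrow>
     (\<forall>i x. \<alpha> i x \<noteq> 0) \<and> (\<forall>i j x. i \<noteq> j \<longrightarrow> \<alpha> i (x + e j) = \<alpha> i x)"

definition cross_ratio_quad ::
  "(int ^ 'n::finite \<Rightarrow> complex) \<Rightarrow> ('n \<Rightarrow> int ^ 'n \<Rightarrow> complex) \<Rightarrow> 'n \<Rightarrow> 'n \<Rightarrow> int ^ 'n \<Rightarrow> bool"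
where
  "cross_ratio_quad f \<alpha> i j x \<longleftrightarrow>
     distinct [f x, f (x + e i), f (x + e i + e j), f (x + e j)] \<and>
     (edge_diff f i x * edge_diff f i (x + e j)) / (edge_diff f j x * edge_diff f j (x + e i))
       = (\<alpha> i x)\<^sup>2 / (\<alpha> j x)\<^sup>2"

definition cross_ratio_system ::
  "(int ^ 'n::finite \<Rightarrow> complex) \<Rightarrow> ('n \<Rightarrow> int ^ 'n \<Rightarrow> complex) \<Rightarrow> bool" where
  "cross_ratio_system f \<alpha> \<longleftrightarrow>
     labelling \<alpha> \<and> (\<forall>i j x. i \<noteq> j \<longrightarrow> cross_ratio_quad f \<alpha> i j x)"

definition vertex_eq ::
  "(int ^ 'n::finite \<Rightarrow> complex) \<Rightarrow> ('n \<Rightarrow> int ^ 'n \<Rightarrow> complex) \<Rightarrow> (int ^ 'n \<Rightarrow> complex)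
     \<Rightarrow> 'n \<Rightarrow> int ^ 'n \<Rightarrow> bool" where
  "vertex_eq f \<alpha> s i x \<longleftrightarrow> edge_diff f i x = \<alpha> i x * s (x + e i) * s x"

definition vertex_map ::
  "(int ^ 'n::finite \<Rightarrow> complex) \<Rightarrow> ('n \<Rightarrow> int ^ 'n \<Rightarrow> complex) \<Rightarrow> (int ^ 'n \<Rightarrow> complex) \<Rightarrow> bool"
where
  "vertex_map f \<alpha> s \<longleftrightarrow> s 0 = 1 \<and> (\<forall>i x. vertex_eq f \<alpha> s i x)"

definition diagonal_net :: "(int ^ 4) set" where
  "diagonal_net = {vector [i, j, i, j] | i j. True}"

definition plus_labels :: "(4 \<Rightarrow> int ^ 4 \<Rightarrow> complex) \<Rightarrow> bool" where
  "plus_labels \<alpha> \<longleftrightarrow>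
     (\<forall>x\<in>diagonal_net. \<alpha> 1 x * cnj (\<alpha> 3 x) = -1 \<and> \<alpha> 2 x * cnj (\<alpha> 4 x) = -1)"

definition minus_labels :: "(4 \<Rightarrow> int ^ 4 \<Rightarrow> complex) \<Rightarrow> bool" where
  "minus_labels \<alpha> \<longleftrightarrow>
     (\<forall>x\<in>diagonal_net. \<alpha> 1 x = cnj (\<alpha> 3 x) \<and> \<alpha> 2 x = cnj (\<alpha> 4 x))"

text \<open>
  The vertex map of a cross-ratio system exists and is unique (it never vanishes, as the
  points of each quad are distinct), so the existential quantifier below merely names it.
\<close>

definition diagonal_condition ::
  "(int ^ 4 \<Rightarrow> complex) \<Rightarrow> (4 \<Rightarrow> int ^ 4 \<Rightarrow> complex) \<Rightarrow> bool" where
  "diagonal_condition f \<alpha> \<longleftrightarrow>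
     (\<exists>s. vertex_map f \<alpha> s \<and>
        (\<forall>x\<in>diagonal_net. s (x + e 1) * cnj (s (x + e 3)) = 1 \<and>
                          s (x + e 2) * cnj (s (x + e 4)) = 1))"

definition C_plus_lattice :: "(int ^ 4 \<Rightarrow> complex) \<Rightarrow> (4 \<Rightarrow> int ^ 4 \<Rightarrow> complex) \<Rightarrow> bool" where
  "C_plus_lattice f \<alpha> \<longleftrightarrow>
     cross_ratio_system f \<alpha> \<and> diagonal_condition f \<alpha> \<and> plus_labels \<alpha>"

definition C_minus_lattice :: "(int ^ 4 \<Rightarrow> complex) \<Rightarrow> (4 \<Rightarrow> int ^ 4 \<Rightarrow> complex) \<Rightarrow> bool" where
  "C_minus_lattice f \<alpha> \<longleftrightarrow>
     cross_ratio_system f \<alpha> \<and> diagonal_condition f \<alpha> \<and> minus_labels \<alpha>"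

definition extends_map :: "(int ^ 4 \<Rightarrow> complex) \<Rightarrow> (int ^ 2 \<Rightarrow> complex) \<Rightarrow> bool" where
  "extends_map F f \<longleftrightarrow> (\<forall>i j. F (vector [i, j, 0, 0]) = f (vector [i, j]))"

definition extends_labels ::
  "(4 \<Rightarrow> int ^ 4 \<Rightarrow> complex) \<Rightarrow> (2 \<Rightarrow> int ^ 2 \<Rightarrow> complex) \<Rightarrow> bool" where
  "extends_labels A \<alpha> \<longleftrightarrow>
     (\<forall>i j. A 1 (vector [i, j, 0, 0]) = \<alpha> 1 (vector [i, j]) \<and>
            A 2 (vector [i, j, 0, 0]) = \<alpha> 2 (vector [i, j]))"

text \<open>
  The evolution. Starting from a two-dimensional cross-ratio system \<open>f\<close> with vertex map \<open>s\<close>,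
  \<open>reached f s A y p \<sigma>\<close> says that at the vertex \<open>y\<close> the point \<open>p\<close>, together with the value \<open>\<sigma>\<close> of
  the vertex map, is obtained in finitely many steps, where \<open>A\<close> is the labelling on \<open>\<int>\<^sup>4\<close>.
  In each step the value at one vertex is determined from values obtained before:

  \<^item> the value at the fourth corner of a quad is computed from those at the other three
    corners by the cross-ratio equation (in any of the four orientations);

  \<^item> at a quad based at \<open>x\<close> in the diagonal net and spanned by the directions \<open>1, 3\<close>
    (or \<open>2, 4\<close>), the condition \<open>s (x + e a) * cnj (s (x + e b)) = 1\<close> passes from one of the two
    middle corners to the other; the point there is then computed along an edge from the base
    corner \<open>x\<close> (used when evolving upwards) or the top corner \<open>x + e a + e b\<close> (used when
    evolving downwards).

  In the rules, \<open>F\<close> and \<open>S\<close> matter only at the corners of the quad under consideration. The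
  relation is not assumed to be single-valued.
\<close>

definition corners :: "int ^ 'n::finite \<Rightarrow> 'n \<Rightarrow> 'n \<Rightarrow> (int ^ 'n) set" where
  "corners x i j = {x, x + e i, x + e j, x + e i + e j}"

inductive reached ::
  "(int ^ 2 \<Rightarrow> complex) \<Rightarrow> (int ^ 2 \<Rightarrow> complex) \<Rightarrow> (4 \<Rightarrow> int ^ 4 \<Rightarrow> complex)
     \<Rightarrow> int ^ 4 \<Rightarrow> complex \<Rightarrow> complex \<Rightarrow> bool"
  for f s :: "int ^ 2 \<Rightarrow> complex" and A :: "4 \<Rightarrow> int ^ 4 \<Rightarrow> complex"
where
  initial: "reached f s A (vector [i, j, 0, 0]) (f (vector [i, j])) (s (vector [i, j]))"
| quad: "reached f s A y (F y) (S y)"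
  if "i \<noteq> j" "y \<in> corners x i j"
     "\<forall>w \<in> corners x i j - {y}. reached f s A w (F w) (S w)"
     "cross_ratio_quad F A i j x"
     "vertex_eq F A S i x" "vertex_eq F A S i (x + e j)"
     "vertex_eq F A S j x" "vertex_eq F A S j (x + e i)"
| diagonal_up: "reached f s A (x + e b) (F (x + e b)) (S (x + e b))"
  if "x \<in> diagonal_net" "(a, b) \<in> {(1, 3), (3, 1), (2, 4), (4, 2)}"
     "reached f s A (x + e a) (F (x + e a)) (S (x + e a))"
     "reached f s A x (F x) (S x)"
     "S (x + e a) * cnj (S (x + e b)) = 1"
     "vertex_eq F A S b x"
| diagonal_down: "reached f s A (x + e b) (F (x + e b)) (S (x + e b))"
  if "x \<in> diagonal_net" "(a, b) \<in> {(1, 3), (3, 1), (2, 4), (4, 2)}"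
     "reached f s A (x + e a) (F (x + e a)) (S (x + e a))"
     "reached f s A (x + e a + e b) (F (x + e a + e b)) (S (x + e a + e b))"
     "S (x + e a) * cnj (S (x + e b)) = 1"
     "vertex_eq F A S a (x + e b)"

text \<open>
  The evolution stays nondegenerate: whenever three corners of a quad have been reached, the
  cross-ratio equation has a solution in \<open>\<complex>\<close> at the fourth corner (it is not \<open>\<infinity>\<close>) and the four
  points are pairwise distinct. Here \<open>P\<close> is \<open>plus_labels\<close> or \<open>minus_labels\<close>; it determines the
  extension \<open>A\<close> of \<open>\<alpha>\<close> to \<open>\<int>\<^sup>4\<close> uniquely. No global solution is presupposed, but
  conversely every step of the evolution is valid in any extension of \<open>f\<close> to a lattice of the type
  in question, so the existence of such an extension implies this condition.
\<close>

definition nondegenerate_evolution ::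
  "((4 \<Rightarrow> int ^ 4 \<Rightarrow> complex) \<Rightarrow> bool) \<Rightarrow> (int ^ 2 \<Rightarrow> complex) \<Rightarrow> (2 \<Rightarrow> int ^ 2 \<Rightarrow> complex) \<Rightarrow> bool"
where
  "nondegenerate_evolution P f \<alpha> \<longleftrightarrow>
     (\<forall>s A. vertex_map f \<alpha> s \<and> labelling A \<and> extends_labels A \<alpha> \<and> P A \<longrightarrow>
        (\<forall>i j x y F. i \<noteq> j \<and> y \<in> corners x i j \<and>
             (\<forall>w \<in> corners x i j - {y}. \<exists>\<sigma>. reached f s A w (F w) \<sigma>) \<longrightarrow>
             (\<exists>z. cross_ratio_quad (F(y := z)) A i j x)))"

lemma vector_4 [simp]:
  "(vector [a, b, c, d] :: 'a::zero ^ 4) $ 1 = a"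
  "(vector [a, b, c, d] :: 'a::zero ^ 4) $ 2 = b"
  "(vector [a, b, c, d] :: 'a::zero ^ 4) $ 3 = c"
  "(vector [a, b, c, d] :: 'a::zero ^ 4) $ 4 = d"
  unfolding vector_def by simp_all

lemma diagonal_net_iff: "x \<in> diagonal_net \<longleftrightarrow> x $ 3 = x $ 1 \<and> x $ 4 = x $ 2"
  by (auto simp: diagonal_net_def vec_eq_iff forall_4)

end

theory Submission
  imports Defs
begin

text \<open>
  Eliminating \<open>f\<close> from the edge equations turns the cross-ratio equation of a quad into
  \<open>s\<^sub>i\<^sub>j (\<alpha>\<^sup>j s\<^sub>i - \<alpha>\<^sup>i s\<^sub>j) = s (\<alpha>\<^sup>j s\<^sub>j - \<alpha>\<^sup>i s\<^sub>i)\<close>, which is three-dimensionally consistent. A solution on a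
  coordinate subspace together with one value in an adjacent parallel layer therefore determines a
  solution on that layer. Such a value is supplied, for the layers in direction 3, by the diagonal
  condition at \<open>(c, 0, c, 0)\<close>, and then, for direction 4, by the one at \<open>(0, c, 0, c)\<close>; all
  values obtained are reached, so nondegeneracy never fails.

  The diagonal condition at the remaining points comes from a symmetry: with \<open>x \<mapsto> x'\<close> exchanging
  the directions 1, 3 and 2, 4, the function \<open>1 / cnj (s x')\<close> (for \<open>C\<^sup>-\<close>; for \<open>C\<^sup>+\<close> one uses
  \<open>cnj (s x')\<close> at the points of even coordinate sum) solves the same equation with the same labels.
  It agrees with \<open>s\<close> on a staircase in each of the coordinate planes 1, 3 and 2, 4, hence
  everywhere. Uniqueness holds since every step of the evolution is forced in any extension.
\<close>

section \<open>Parallel transport on the lattice\<close>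

text \<open>The obstacle is that nondegeneracy is granted only for reached values. A solution cannot
  be written down first and checked afterwards: every value carries a proof of
  \<open>reached\<close>, and layers are built by transporting pairs (point, value of the vertex
  map) across quads. Three-dimensional consistency is what makes this transport independent of the
  path. The diagonal condition is overdetermined: one instance per layer already fixes the layer, so
  the remaining ones must come out as consequences, and this is what the symmetry is for. The parity
  in the C^+ case comes from the labels. Passing from z to -1 / cnj z inverts them up to conjugation
  and sign; the sign drops out because the quad equation is homogeneous in the labels, and inverting
  both labels amounts to inverting the vertex map at two opposite corners of the quad. The points of
  even coordinate sum contain exactly one pair of opposite corners of each quad. Neighbours of the
  diagonal net have odd sum, so there the transformed map is 1 / cnj (s x') in both cases.\<close>

definition coset :: "int ^ 'n::finite \<Rightarrow> 'n set \<Rightarrow> (int ^ 'n) set" where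
  "coset v I = {x. \<forall>m. m \<notin> I \<longrightarrow> x $ m = v $ m}"

lemma coset_self [simp]: "v \<in> coset v I"
  by (simp add: coset_def)

lemma coset_add [simp]: "i \<in> I \<Longrightarrow> x + axis i c \<in> coset v I \<longleftrightarrow> x \<in> coset v I"
  by (auto simp: coset_def axis_def)

lemma coset_diff [simp]: "i \<in> I \<Longrightarrow> x - axis i c \<in> coset v I \<longleftrightarrow> x \<in> coset v I"
  by (auto simp: coset_def axis_def)

lemma coset_step_iff:
  assumes "x \<in> coset v I"
  shows "x + e i \<in> coset v I \<longleftrightarrow> i \<in> I"
proof
  assume "x + e i \<in> coset v I"
  with assms have "i \<notin> I \<Longrightarrow> e i $ i = (0 :: int)" by (auto simp: coset_def)
  then show "i \<in> I" by auto
qed (use assms in simp)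

lemma coset_add_insert: "x \<in> coset (v + axis j c) I \<Longrightarrow> x \<in> coset v (insert j I)"
  by (auto simp: coset_def axis_def)

lemma axis_zero [simp]: "axis i 0 = (0 :: 'a::zero ^ 'n)"
  by (auto simp: vec_eq_iff axis_def)

lemma axis_add: "axis i (a + b) = axis i a + (axis i b :: 'a::monoid_add ^ 'n)"
  by (auto simp: vec_eq_iff axis_def)

lemma axis_minus_one: "axis i (-1) = - (e i :: int ^ 'n::finite)"
  by (auto simp: vec_eq_iff axis_def)

lemma axis_line_induct:
  fixes x :: "int ^ 'n::finite"
  assumes "P x" and "\<And>c. P (x + axis i c) \<Longrightarrow> P (x + axis i c + e i)"
    and "\<And>c. P (x + axis i c + e i) \<Longrightarrow> P (x + axis i c)"
  shows "P (x + axis i c)"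
proof (induction c rule: int_induct[of _ 0])
  case base
  then show ?case using assms(1) by simp
next
  case (step1 c)
  then show ?case using assms(2)[of c] by (simp add: axis_add add.assoc)
next
  case (step2 c)
  have "x + axis i (c - 1) + e i = x + axis i c"
    by (auto simp: vec_eq_iff axis_def)
  with step2 have "P (x + axis i (c - 1) + e i)" by (simp only:)
  then show ?case by (rule assms(3))
qed

text \<open>Every point of the coset is joined to \<open>v\<close> by unit steps inside it.
  Coordinates run over all integers, so \<open>P\<close> has to pass along an edge in both
  directions.\<close>

lemma coset_induct [consumes 1, case_names base up down]:
  fixes v :: "int ^ 'n::finite"
  assumes "x \<in> coset v I" and "P v"
    and up: "\<And>x i. x \<in> coset v I \<Longrightarrow> i \<in> I \<Longrightarrow> P x \<Longrightarrow> P (x + e i)"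
    and down: "\<And>x i. x \<in> coset v I \<Longrightarrow> i \<in> I \<Longrightarrow> P (x + e i) \<Longrightarrow> P x"
  shows "P x"
proof -
  have "finite I" by simp
  then have "\<forall>x. x \<in> coset v I \<longrightarrow> P x" using up down
  proof (induction I rule: finite_induct)
    case empty
    then show ?case using \<open>P v\<close> by (auto simp: coset_def simp flip: vec_eq_iff)
  next
    case (insert j J)
    have sub: "coset v J \<subseteq> coset v (insert j J)"
      by (auto simp: coset_def)
    have IH: "\<forall>x. x \<in> coset v J \<longrightarrow> P x"
      by (rule insert.IH) (use insert.prems sub in blast)+
    show ?case
    proof (intro allI impI)
      fix x assume x: "x \<in> coset v (insert j J)"
      define y where "y = x + axis j (v $ j - x $ j)"
      have y: "y \<in> coset v J"
        using x by (auto simp: coset_def y_def axis_def)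
      have "P (y + axis j (x $ j - v $ j))"
      proof (rule axis_line_induct)
        fix c
        have "y + axis j c \<in> coset v (insert j J)"
          using y sub by auto
        then show "P (y + axis j c) \<Longrightarrow> P (y + axis j c + e j)"
          and "P (y + axis j c + e j) \<Longrightarrow> P (y + axis j c)"
          using insert.prems by blast+
      qed (use y IH in blast)
      also have "y + axis j (x $ j - v $ j) = x"
        by (auto simp: y_def vec_eq_iff axis_def)
      finally show "P x" .
    qed
  qed
  with assms(1) show ?thesis by blast
qed

text \<open>Two one-sided dependent choices are glued at 0. The negative half runs away from 0, so
  \<open>R\<close> relates a later choice to an earlier one there.\<close>

lemma int_dependent_choice:
  assumes "P 0 a"
    and up: "\<And>n x. P n x \<Longrightarrow> \<exists>y. P (n + 1) y \<and> R n x y"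
    and down: "\<And>n y. P (n + 1) y \<Longrightarrow> \<exists>x. P n x \<and> R n x y"
  shows "\<exists>h. h 0 = a \<and> (\<forall>n::int. P n (h n) \<and> R n (h n) (h (n + 1)))"
proof -
  \<comment> \<open>Dependent choice leaves the starting element open; the clause for
    \<open>n = 0\<close> pins it to \<open>a\<close>, so that the two halves fit together.\<close>
  have "\<exists>h. \<forall>n. (P (int n) (h n) \<and> (n = 0 \<longrightarrow> h n = a)) \<and> R (int n) (h n) (h (Suc n))"
    using assms(1) up[of "int _"] by (intro dependent_nat_choice) (auto simp: add.commute)
  then obtain g where g: "g 0 = a" "\<And>n. P (int n) (g n)" "\<And>n. R (int n) (g n) (g (Suc n))"
    by blast
  have "\<exists>h. \<forall>n. (P (- int n) (h n) \<and> (n = 0 \<longrightarrow> h n = a)) \<and> R (- int (Suc n)) (h (Suc n)) (h n)"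
  proof (intro dependent_nat_choice)
    fix x n assume "P (- int n) x \<and> (n = 0 \<longrightarrow> x = a)"
    then show "\<exists>y. (P (- int (Suc n)) y \<and> (Suc n = 0 \<longrightarrow> y = a)) \<and> R (- int (Suc n)) y x"
      using down[of "- int (Suc n)" x] by simp
  qed (use assms(1) in auto)
  then obtain k where k: "k 0 = a" "\<And>n. P (- int n) (k n)" "\<And>n. R (- int (Suc n)) (k (Suc n)) (k n)"
    by blast
  define h where "h n = (if n \<ge> 0 then g (nat n) else k (nat (- n)))" for n
  have "P n (h n) \<and> R n (h n) (h (n + 1))" for n
  proof (cases "n \<ge> 0")
    case True
    then show ?thesis using g(2)[of "nat n"] g(3)[of "nat n"]
      by (simp add: h_def Suc_nat_eq_nat_zadd1 add.commute)
  next
    case False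
    define m where "m = nat (- n - 1)"
    have n: "n = - int (Suc m)" using False by (simp add: m_def)
    have "h (n + 1) = k m"
      using g(1) k(1) by (auto simp: h_def n)
    moreover have "h n = k (Suc m)"
      by (simp add: h_def n nat_add_distrib)
    ultimately show ?thesis using k(2)[of "Suc m"] k(3)[of m] n by simp
  qed
  then show ?thesis using g(1) by (intro exI[of _ h]) (simp add: h_def)
qed

text \<open>\<open>E i\<close> is a bijective correspondence between neighbouring fibres
  \<open>X x\<close> and \<open>X (x + e i)\<close>, and \<open>flat\<close> says that the transport around a quad is trivial.\<close>

lemma section_exists:
  fixes X :: "int ^ 'n::finite \<Rightarrow> 'a set" and E :: "'n \<Rightarrow> int ^ 'n \<Rightarrow> 'a \<Rightarrow> 'a \<Rightarrow> bool"
  assumes fwd: "\<And>i x a. i \<in> I \<Longrightarrow> x \<in> coset v I \<Longrightarrow> a \<in> X x \<Longrightarrow> \<exists>b\<in>X (x + e i). E i x a b"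
    and bwd: "\<And>i x b. i \<in> I \<Longrightarrow> x \<in> coset v I \<Longrightarrow> b \<in> X (x + e i) \<Longrightarrow> \<exists>a\<in>X x. E i x a b"
    and uniq_fwd: "\<And>i x a b b'. i \<in> I \<Longrightarrow> x \<in> coset v I \<Longrightarrow> a \<in> X x \<Longrightarrow> b \<in> X (x + e i) \<Longrightarrow>
      b' \<in> X (x + e i) \<Longrightarrow> E i x a b \<Longrightarrow> E i x a b' \<Longrightarrow> b = b'"
    and uniq_bwd: "\<And>i x a a' b. i \<in> I \<Longrightarrow> x \<in> coset v I \<Longrightarrow> a \<in> X x \<Longrightarrow> a' \<in> X x \<Longrightarrow>
      b \<in> X (x + e i) \<Longrightarrow> E i x a b \<Longrightarrow> E i x a' b \<Longrightarrow> a = a'"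
    and flat: "\<And>i j x a b b' c. i \<in> I \<Longrightarrow> j \<in> I \<Longrightarrow> i \<noteq> j \<Longrightarrow> x \<in> coset v I \<Longrightarrow> a \<in> X x \<Longrightarrow>
      b \<in> X (x + e i) \<Longrightarrow> b' \<in> X (x + e j) \<Longrightarrow> c \<in> X (x + e j + e i) \<Longrightarrow>
      E i x a b \<Longrightarrow> E j x a b' \<Longrightarrow> E i (x + e j) b' c \<Longrightarrow> E j (x + e i) b c"
    and "a \<in> X v"
  shows "\<exists>g. g v = a \<and> (\<forall>x\<in>coset v I. g x \<in> X x \<and> (\<forall>i\<in>I. E i x (g x) (g (x + e i))))"
proof -
  \<comment> \<open>Induction on the set of directions. Base point and value stay general because
    the induction hypothesis is applied at every point of a line.\<close>
  have "\<exists>g. g w = a \<and> (\<forall>x\<in>coset w J. g x \<in> X x \<and> (\<forall>i\<in>J. E i x (g x) (g (x + e i))))"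
    if "finite J" "J \<subseteq> I" "w \<in> coset v I" "a \<in> X w" for J w a
    using that
  proof (induction J arbitrary: w a rule: finite_induct)
    case empty
    have "coset w {} = {w}" by (auto simp: coset_def simp flip: vec_eq_iff)
    then show ?case using empty by auto
  next
    case (insert j J)
    have j: "j \<in> I" "j \<notin> J" using insert by auto
    have wI: "coset w (insert j J) \<subseteq> coset v I"
      using insert.prems by (auto simp: coset_def)
    have on_line: "w + axis j c \<in> coset v I" for c
      using insert.prems j by simp
    have line: "w + axis j (c + 1) = w + axis j c + e j" for c
      by (simp add: axis_add add.assoc)
    \<comment> \<open>Values along the \<open>j\<close>-line through \<open>w\<close>, by
      \<open>fwd\<close> upwards and \<open>bwd\<close> downwards; each of them seeds a section over
      its own slice.\<close>
    have "\<exists>h. h 0 = a \<and> (\<forall>n. h n \<in> X (w + axis j n) \<and> E j (w + axis j n) (h n) (h (n + 1)))"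
      using insert.prems fwd[OF j(1) on_line] bwd[OF j(1) on_line]
      by (intro int_dependent_choice[where P = "\<lambda>n y. y \<in> X (w + axis j n)"])
         (auto simp: line Bex_def)
    then obtain h where h0: "h 0 = a"
      and h: "\<And>n. h n \<in> X (w + axis j n)" "\<And>n. E j (w + axis j n) (h n) (h (n + 1))"
      by blast
    have "\<exists>g. g (w + axis j n) = h n \<and>
      (\<forall>x\<in>coset (w + axis j n) J. g x \<in> X x \<and> (\<forall>i\<in>J. E i x (g x) (g (x + e i))))" for n
      by (rule insert.IH) (use insert.prems h j in auto)
    then obtain g where g0: "\<And>n. g n (w + axis j n) = h n"
      and gX: "\<And>n x. x \<in> coset (w + axis j n) J \<Longrightarrow> g n x \<in> X x"
      and gE: "\<And>n x i. x \<in> coset (w + axis j n) J \<Longrightarrow> i \<in> J \<Longrightarrow> E i x (g n x) (g n (x + e i))"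
      by metis
    \<comment> \<open>The slices were chosen separately and are linked only over the line. Flatness
      spreads the \<open>j\<close>-correspondence from there over whole slices.\<close>
    have across: "E j x (g n x) (g (n + 1) (x + e j))" if "x \<in> coset (w + axis j n) J" for n x
      using that
    proof (induction rule: coset_induct)
      case base
      then show ?case using h(2)[of n] g0[of n] g0[of "n + 1"] by (simp add: line)
    next
      case (up x i)
      have i: "i \<in> I" "i \<noteq> j" using up insert j by auto
      have x': "x + e j \<in> coset (w + axis j (n + 1)) J"
        using up by (auto simp: coset_def axis_def)
      have x: "x \<in> coset v I" using up wI coset_add_insert by blast
      have "E j (x + e i) (g n (x + e i)) (g (n + 1) (x + e j + e i))"
        by (rule flat[OF i(1) j(1) i(2) x]) (use up x' gX gE in auto)
      then show ?case by (simp add: algebra_simps)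
    next
      case (down x i)
      have i: "i \<in> I" "i \<noteq> j" using down insert j by auto
      have x': "x + e j \<in> coset (w + axis j (n + 1)) J"
        using down by (auto simp: coset_def axis_def)
      have x: "x \<in> coset v I" using down wI coset_add_insert by blast
      have exchange: "x + e i + e j = x + e j + e i" by (simp add: algebra_simps)
      have gx: "g n x \<in> X x" and gxi: "g n (x + e i) \<in> X (x + e i)"
        using down gX by auto
      \<comment> \<open>Flatness only carries a correspondence forward, so the step back goes around
        the quad: the \<open>j\<close>-partner \<open>b\<close> of \<open>g n x\<close> is pushed
        along \<open>i\<close> to \<open>c\<close>, flatness and uniqueness identify
        \<open>c\<close> with the value of the next slice, and \<open>uniq_bwd\<close> then
        identifies \<open>b\<close>.\<close>
      obtain b where b: "b \<in> X (x + e j)" "E j x (g n x) b"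
        using fwd[OF j(1) x gx] by blast
      obtain c where c: "c \<in> X (x + e j + e i)" "E i (x + e j) b c"
        using fwd[OF i(1) _ b(1)] x j by auto
      have "E j (x + e i) (g n (x + e i)) c"
        using flat[OF i(1) j(1) i(2) x gx gxi b(1) c(1) _ b(2) c(2)] gE down by blast
      moreover have mem: "g (n + 1) (x + e j + e i) \<in> X (x + e j + e i)"
        using x' down(2) gX by simp
      ultimately have "c = g (n + 1) (x + e j + e i)"
        using uniq_fwd[OF j(1), of "x + e i" "g n (x + e i)" c] x i gxi c(1) down(3)
        by (simp add: exchange)
      with c have "b = g (n + 1) (x + e j)"
        using uniq_bwd[OF i(1), of "x + e j" b] x j b(1) mem gX[OF x'] gE[OF x' down(2)] by auto
      with b(2) show ?case by simp
    qed
    define G where "G x = g (x $ j - w $ j) x" for x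
    have on: "x \<in> coset (w + axis j (x $ j - w $ j)) J" if "x \<in> coset w (insert j J)" for x
      using that by (auto simp: coset_def axis_def)
    have "G w = a" using g0[of 0] h0 by (simp add: G_def)
    moreover have "G x \<in> X x" if "x \<in> coset w (insert j J)" for x
      unfolding G_def by (rule gX[OF on[OF that]])
    moreover have "E i x (G x) (G (x + e i))" if "x \<in> coset w (insert j J)" "i \<in> insert j J" for x i
    proof (cases "i = j")
      case True
      then show ?thesis using across[OF on[OF that(1)]] by (simp add: G_def add_diff_eq axis_def algebra_simps)
    next
      case False
      then have "(x + e i) $ j = x $ j" "i \<in> J" using that by (auto simp: axis_def)
      then show ?thesis using gE[OF on[OF that(1)], of i] by (simp add: G_def)
    qed
    ultimately show ?case by blast
  qed
  from this[of I v a] \<open>a \<in> X v\<close> show ?thesis by simp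
qed

section \<open>Quads and three-dimensional consistency\<close>

lemma quad_points:
  fixes x :: "int ^ 'n::finite"
  assumes "i \<noteq> j"
  shows "x + e i \<noteq> x" "x + e i + e j \<noteq> x" "x + e i \<noteq> x + e j" "x + e i + e j \<noteq> x + e i"
    "x + e i + e j \<noteq> x + e j"
  using assms by (auto simp: vec_eq_iff axis_def)

lemma labelling_nonzero: "labelling A \<Longrightarrow> A i x \<noteq> 0"
  by (simp add: labelling_def)

lemma labelling_cong:
  assumes "labelling A" "x $ i = y $ i"
  shows "A i x = A i y"
proof -
  have "x \<in> coset y (- {i})" using assms(2) by (simp add: coset_def)
  then show ?thesis
    by (induction rule: coset_induct) (use assms(1) in \<open>auto simp: labelling_def\<close>)
qed

text \<open>The label of the edge traversed from \<open>x\<close> to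
  \<open>x + axis i \<epsilon>\<close> for \<epsilon> = 1 or -1; the minus sign absorbs the reversed
  edge difference. All four orientations of a quad then obey the same formulas.\<close>

definition signed_label :: "('n::finite \<Rightarrow> int ^ 'n \<Rightarrow> complex) \<Rightarrow> 'n \<Rightarrow> int \<Rightarrow> int ^ 'n \<Rightarrow> complex"
where
  "signed_label A i \<epsilon> x = (if \<epsilon> = 1 then A i x else - A i (x - e i))"

lemma signed_label_cong:
  assumes "labelling A" "x $ i = y $ i"
  shows "signed_label A i \<epsilon> x = signed_label A i \<epsilon> y"
  using labelling_cong[OF assms(1), of x i y] labelling_cong[OF assms(1), of "x - e i" i "y - e i"] assms(2)
  by (simp add: signed_label_def)

lemma cross_ratio_quad_iff:
  assumes "labelling A"
  shows "cross_ratio_quad F A i j x \<longleftrightarrow>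
     distinct [F x, F (x + e i), F (x + e i + e j), F (x + e j)] \<and>
     edge_diff F i x * edge_diff F i (x + e j) * (A j x)\<^sup>2 =
     edge_diff F j x * edge_diff F j (x + e i) * (A i x)\<^sup>2"
  unfolding cross_ratio_quad_def
proof (rule conj_cong[OF refl])
  assume "distinct [F x, F (x + e i), F (x + e i + e j), F (x + e j)]"
  moreover have "x + e j + e i = x + e i + e j" by (simp add: algebra_simps)
  ultimately have "edge_diff F j x * edge_diff F j (x + e i) \<noteq> 0"
    by (auto simp: edge_diff_def)
  then show "(edge_diff F i x * edge_diff F i (x + e j) / (edge_diff F j x * edge_diff F j (x + e i)) =
      (A i x)\<^sup>2 / (A j x)\<^sup>2) =
    (edge_diff F i x * edge_diff F i (x + e j) * (A j x)\<^sup>2 =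
     edge_diff F j x * edge_diff F j (x + e i) * (A i x)\<^sup>2)"
    using labelling_nonzero[OF assms] by (simp add: frac_eq_eq mult_ac)
qed

text \<open>Substituting three edge equations into the cross-ratio identity leaves the fourth,
  multiplied by the nonzero factor \<open>a * b\<^sup>2 * u * v\<close>. Here \<open>u\<close>,
  \<open>v\<close>, \<open>w\<close>, \<open>t\<close> are the vertex values, with \<open>u\<close>
  opposite to \<open>t\<close>.\<close>

lemma fourth_edge:
  fixes a b :: "'a::field"
  assumes "d1 * d1' * b\<^sup>2 = d2 * d2' * a\<^sup>2" "d1 = a * u * v" "d2 = b * u * w" "d2' = b * v * t"
    and "a \<noteq> 0" "b \<noteq> 0" "u \<noteq> 0" "v \<noteq> 0"
  shows "d1' = a * w * t"
proof -
  have "(a * b\<^sup>2 * u * v) * d1' = (a * b\<^sup>2 * u * v) * (a * w * t)"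
    using assms(1) unfolding assms(2-4) by (simp add: power2_eq_square algebra_simps)
  with assms(5-) show ?thesis by simp
qed

text \<open>The two edge equations at the missing corner are linear in the point and its vertex
  value. Subtraction eliminates the point, and the coefficient of the vertex value is nonzero
  because the two neighbouring points differ.\<close>

lemma fourth_corner_unique:
  fixes p q :: "'a::field"
  assumes "q - p1 = b * s1 * \<sigma>" "q - p2 = a * s2 * \<sigma>" "q' - p1 = b * s1 * \<sigma>'" "q' - p2 = a * s2 * \<sigma>'"
    and "p1 \<noteq> p2"
  shows "q = q' \<and> \<sigma> = \<sigma>'"
proof -
  have *: "(a * s2 - b * s1) * \<sigma> = p1 - p2" "(a * s2 - b * s1) * \<sigma>' = p1 - p2"
    using assms(1-4) by (simp_all add: algebra_simps)
  with \<open>p1 \<noteq> p2\<close> have "a * s2 - b * s1 \<noteq> 0" by auto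
  with * have "\<sigma> = \<sigma>'" by (metis mult_left_cancel)
  with assms(1,3) show ?thesis by (metis diff_add_cancel)
qed

section \<open>The evolution\<close>

text \<open>Nondegeneracy for one fixed vertex map and one fixed labelling. Both kinds of lattice
  are covered at once; their label relations come into play in
  \<open>global_solution\<close>.\<close>

locale evolution =
  fixes f s :: "int ^ 2 \<Rightarrow> complex" and A :: "4 \<Rightarrow> int ^ 4 \<Rightarrow> complex"
  assumes labelling: "labelling A"
    and initial_nonzero: "\<And>i j. s (vector [i, j]) \<noteq> 0"
    and nondegenerate: "\<And>i j x y F. i \<noteq> j \<Longrightarrow> y \<in> corners x i j \<Longrightarrow>
      \<forall>w \<in> corners x i j - {y}. \<exists>\<sigma>. reached f s A w (F w) \<sigma> \<Longrightarrow>
      \<exists>z. cross_ratio_quad (F(y := z)) A i j x"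
begin

abbreviation "reach \<equiv> reached f s A"

text \<open>In a quad the points are distinct, so each edge difference is nonzero and so are the
  factors in its vertex equation; in the diagonal rules the two values have product 1 up to
  conjugation.\<close>

lemma reach_nonzero: "reach y p \<sigma> \<Longrightarrow> \<sigma> \<noteq> 0"
proof (induction rule: reached.induct)
  case (initial i j)
  then show ?case by (rule initial_nonzero)
next
  case (quad i j y x F S)
  have "S x \<noteq> 0" "S (x + e i) \<noteq> 0" "S (x + e j) \<noteq> 0" "S (x + e i + e j) \<noteq> 0"
    using quad.hyps by (auto simp: cross_ratio_quad_def vertex_eq_def edge_diff_def)
  then show ?case using quad.hyps(2) by (auto simp: corners_def)
qed auto

text \<open>Nondegeneracy supplies the point at \<open>y\<close>, division along one edge at
  \<open>y\<close> its vertex value, and \<open>fourth_edge\<close> the equation on the other edge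
  at \<open>y\<close>. The premises \<open>v\<close> are the equations on the two edges that avoid
  \<open>y\<close>.\<close>

lemma fill_quad:
  assumes "i \<noteq> j" "y \<in> corners x i j" and r: "\<forall>w \<in> corners x i j - {y}. reach w (F w) (S w)"
    and v: "y \<notin> {x, x + e i} \<Longrightarrow> vertex_eq F A S i x"
      "y \<notin> {x + e j, x + e i + e j} \<Longrightarrow> vertex_eq F A S i (x + e j)"
      "y \<notin> {x, x + e j} \<Longrightarrow> vertex_eq F A S j x"
      "y \<notin> {x + e i, x + e i + e j} \<Longrightarrow> vertex_eq F A S j (x + e i)"
  obtains p \<sigma> F' S' where "F' = F(y := p)" "S' = S(y := \<sigma>)" "reach y p \<sigma>"
    "cross_ratio_quad F' A i j x" "vertex_eq F' A S' i x" "vertex_eq F' A S' i (x + e j)"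
    "vertex_eq F' A S' j x" "vertex_eq F' A S' j (x + e i)"
proof -
  obtain p where cr: "cross_ratio_quad (F(y := p)) A i j x"
    using nondegenerate[OF assms(1,2), of F] r by blast
  define F' where "F' = F(y := p)"
  have sw: "x + e j + e i = x + e i + e j" by (simp add: algebra_simps)
  have lab: "A i (x + e j) = A i x" "A j (x + e i) = A j x"
    using labelling assms(1) by (auto simp: labelling_def)
  note nz = labelling_nonzero[OF labelling]
  note pts = quad_points[OF assms(1), of x] quad_points[OF assms(1)[symmetric], of x]
  note pts = pts pts[symmetric]
  have S0: "S w \<noteq> 0" if "w \<in> corners x i j" "w \<noteq> y" for w
    using r that reach_nonzero by blast
  have cross: "(F' (x + e i) - F' x) * (F' (x + e i + e j) - F' (x + e j)) * (A j x)\<^sup>2 =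
     (F' (x + e j) - F' x) * (F' (x + e i + e j) - F' (x + e i)) * (A i x)\<^sup>2"
    using cr by (simp add: cross_ratio_quad_iff[OF labelling] F'_def edge_diff_def sw)
  have "\<exists>\<sigma>. vertex_eq F' A (S(y := \<sigma>)) i x \<and> vertex_eq F' A (S(y := \<sigma>)) i (x + e j) \<and>
    vertex_eq F' A (S(y := \<sigma>)) j x \<and> vertex_eq F' A (S(y := \<sigma>)) j (x + e i)"
  proof -
    consider "y = x" | "y = x + e i" | "y = x + e j" | "y = x + e i + e j"
      using assms(2) by (auto simp: corners_def)
    then show ?thesis
    proof cases
      case 1
      define \<sigma> where "\<sigma> = (F' (x + e i) - F' x) / (A i x * S (x + e i))"
      have nzS: "S (x + e i) \<noteq> 0" "S (x + e j) \<noteq> 0" "S (x + e i + e j) \<noteq> 0"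
        using S0 pts 1 by (auto simp: corners_def)
      have ev: "F' (x + e i + e j) - F' (x + e j) = A i x * S (x + e i + e j) * S (x + e j)"
        "F' (x + e i + e j) - F' (x + e i) = A j x * S (x + e i + e j) * S (x + e i)"
        using v 1 pts by (auto simp: vertex_eq_def edge_diff_def F'_def lab sw)
      have d: "F' (x + e i) - F' x = A i x * S (x + e i) * \<sigma>"
        using nzS nz by (simp add: \<sigma>_def)
      have "F' (x + e j) - F' x = A j x * S (x + e j) * \<sigma>"
        by (rule fourth_edge[OF _ ev(2,1) d]) (use cross nz nzS in \<open>simp_all add: mult.commute\<close>)
      then show ?thesis using 1 pts ev d
        by (intro exI[of _ \<sigma>]) (auto simp: vertex_eq_def edge_diff_def lab sw)
    next
      case 2
      define \<sigma> where "\<sigma> = (F' (x + e i) - F' x) / (A i x * S x)"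
      have nzS: "S x \<noteq> 0" "S (x + e j) \<noteq> 0" "S (x + e i + e j) \<noteq> 0"
        using S0 pts 2 by (auto simp: corners_def)
      have ev: "F' (x + e i + e j) - F' (x + e j) = A i x * S (x + e j) * S (x + e i + e j)"
        "F' (x + e j) - F' x = A j x * S x * S (x + e j)"
        using v 2 pts by (auto simp: vertex_eq_def edge_diff_def F'_def lab sw)
      have d: "F' (x + e i) - F' x = A i x * S x * \<sigma>"
        using nzS nz by (simp add: \<sigma>_def)
      have "F' (x + e i + e j) - F' (x + e i) = A j x * \<sigma> * S (x + e i + e j)"
        by (rule fourth_edge[OF _ ev(2) d ev(1)]) (use cross nz nzS in simp_all)
      then show ?thesis using 2 pts ev d
        by (intro exI[of _ \<sigma>]) (auto simp: vertex_eq_def edge_diff_def lab sw)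
    next
      case 3
      define \<sigma> where "\<sigma> = (F' (x + e j) - F' x) / (A j x * S x)"
      have nzS: "S x \<noteq> 0" "S (x + e i) \<noteq> 0" "S (x + e i + e j) \<noteq> 0"
        using S0 pts 3 by (auto simp: corners_def)
      have ev: "F' (x + e i + e j) - F' (x + e i) = A j x * S (x + e i) * S (x + e i + e j)"
        "F' (x + e i) - F' x = A i x * S x * S (x + e i)"
        using v 3 pts by (auto simp: vertex_eq_def edge_diff_def F'_def lab sw)
      have d: "F' (x + e j) - F' x = A j x * S x * \<sigma>"
        using nzS nz by (simp add: \<sigma>_def)
      have "F' (x + e i + e j) - F' (x + e j) = A i x * \<sigma> * S (x + e i + e j)"
        by (rule fourth_edge[OF _ ev(2) d ev(1)]) (use cross nz nzS in simp_all)
      then show ?thesis using 3 pts ev d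
        by (intro exI[of _ \<sigma>]) (auto simp: vertex_eq_def edge_diff_def lab sw)
    next
      case 4
      define \<sigma> where "\<sigma> = (F' (x + e i + e j) - F' (x + e i)) / (A j x * S (x + e i))"
      have nzS: "S x \<noteq> 0" "S (x + e i) \<noteq> 0" "S (x + e j) \<noteq> 0"
        using S0 pts 4 by (auto simp: corners_def)
      have ev: "F' (x + e i) - F' x = A i x * S x * S (x + e i)"
        "F' (x + e j) - F' x = A j x * S x * S (x + e j)"
        using v 4 pts by (auto simp: vertex_eq_def edge_diff_def F'_def lab sw)
      have d: "F' (x + e i + e j) - F' (x + e i) = A j x * S (x + e i) * \<sigma>"
        using nzS nz by (simp add: \<sigma>_def)
      have "F' (x + e i + e j) - F' (x + e j) = A i x * S (x + e j) * \<sigma>"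
        by (rule fourth_edge[OF _ ev d]) (use cross nz nzS in simp_all)
      then show ?thesis using 4 pts ev d
        by (intro exI[of _ \<sigma>]) (auto simp: vertex_eq_def edge_diff_def lab sw)
    qed
  qed
  then obtain \<sigma> where \<sigma>: "vertex_eq F' A (S(y := \<sigma>)) i x" "vertex_eq F' A (S(y := \<sigma>)) i (x + e j)"
    "vertex_eq F' A (S(y := \<sigma>)) j x" "vertex_eq F' A (S(y := \<sigma>)) j (x + e i)" by blast
  have "reach y (F' y) ((S(y := \<sigma>)) y)"
    by (rule reached.quad[OF assms(1,2) _ _ \<sigma>]) (use r cr in \<open>auto simp: F'_def\<close>)
  then show ?thesis
    by (intro that[OF F'_def refl]) (use \<sigma> cr in \<open>auto simp: F'_def\<close>)
qed

text \<open>The orientation-free form of \<open>fill_quad\<close>: \<open>z\<close> is the corner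
  opposite to the missing one, and values take the place of functions. The inequality of the
  neighbours is recorded because \<open>fourth_corner_unique\<close> depends on it.\<close>

lemma fill:
  assumes "i \<noteq> j" "\<bar>\<epsilon>\<bar> = 1" "\<bar>\<delta>\<bar> = 1" "reach z p0 s0" "reach (z + axis i \<epsilon>) p1 s1"
    "reach (z + axis j \<delta>) p2 s2"
    "p1 - p0 = signed_label A i \<epsilon> z * s0 * s1" "p2 - p0 = signed_label A j \<delta> z * s0 * s2"
  shows "p1 \<noteq> p2 \<and> (\<exists>p \<sigma>. reach (z + axis i \<epsilon> + axis j \<delta>) p \<sigma> \<and>
    p - p1 = signed_label A j \<delta> z * s1 * \<sigma> \<and> p - p2 = signed_label A i \<epsilon> z * s2 * \<sigma>)"
proof -
  define y where "y = z + axis i \<epsilon> + axis j \<delta>"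
  define z1 z2 where "z1 = z + axis i \<epsilon>" and "z2 = z + axis j \<delta>"
  define l1 l2 where "l1 = signed_label A i \<epsilon> z" and "l2 = signed_label A j \<delta> z"
  note a = assms(4-8)[folded z1_def z2_def l1_def l2_def]
  \<comment> \<open>Any functions with the three given values will do; the default at the missing
    corner is overwritten by \<open>fill_quad\<close>.\<close>
  define F where "F = (\<lambda>w. if w = z then p0 else if w = z + axis i \<epsilon> then p1 else p2)"
  define S where "S = (\<lambda>w. if w = z then s0 else if w = z + axis i \<epsilon> then s1 else s2)"
  \<comment> \<open>The lowest corner of the quad, at which \<open>cross_ratio_quad\<close> and
    \<open>corners\<close> are based.\<close>
  define x where "x = z - (if \<epsilon> = 1 then 0 else e i) - (if \<delta> = 1 then 0 else e j)"
  note pts = quad_points[OF assms(1), of x] quad_points[OF assms(1)[symmetric], of x]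
  note pts = pts pts[symmetric]
  have sw: "x + e j + e i = x + e i + e j" by (simp add: algebra_simps)
  have lab: "A i (x + e j) = A i x" "A j (x + e i) = A j x"
    using labelling assms(1) by (auto simp: labelling_def)
  have "axis i \<epsilon> \<noteq> 0" "axis j \<delta> \<noteq> 0" "axis j \<delta> \<noteq> axis i \<epsilon>"
    using assms(1-3) by (auto simp: vec_eq_iff axis_def)
  then have FS: "F z = p0" "F z1 = p1" "F z2 = p2"
    "S z = s0" "S z1 = s1" "S z2 = s2"
    by (auto simp: F_def S_def z1_def z2_def)
  consider "\<epsilon> = 1" "\<delta> = 1" | "\<epsilon> = -1" "\<delta> = 1" | "\<epsilon> = 1" "\<delta> = -1" | "\<epsilon> = -1" "\<delta> = -1"
    using assms(2,3) by linarith
  then have "p1 \<noteq> p2 \<and> (\<exists>p \<sigma>. reach y p \<sigma> \<and> p - p1 = l2 * s1 * \<sigma> \<and> p - p2 = l1 * s2 * \<sigma>)"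
  proof cases
    case 1
    have *: "z = x" "z1 = x + e i" "z2 = x + e j" "y = x + e i + e j"
      by (simp_all add: x_def y_def z1_def z2_def 1 axis_minus_one)
    have L: "l1 = A i x" "l2 = A j x"
      using lab by (simp_all add: signed_label_def * l1_def l2_def 1)
    note FS' = FS[unfolded *]
    note a' = a[unfolded * L] FS'
    obtain p \<sigma> F' S' where F': "F' = F(y := p)" and S': "S' = S(y := \<sigma>)" and "reach y p \<sigma>"
      and cr: "cross_ratio_quad F' A i j x"
      and v: "vertex_eq F' A S' i x" "vertex_eq F' A S' i (x + e j)"
        "vertex_eq F' A S' j x" "vertex_eq F' A S' j (x + e i)"
      by (rule fill_quad[OF assms(1), of y x F S])
        (use pts a' in \<open>auto simp: corners_def * L vertex_eq_def edge_diff_def lab sw algebra_simps\<close>)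
    have eqs: "F' (x + e i) - F' x = A i x * S' (x + e i) * S' x"
      "F' (x + e i + e j) - F' (x + e j) = A i x * S' (x + e i + e j) * S' (x + e j)"
      "F' (x + e j) - F' x = A j x * S' (x + e j) * S' x"
      "F' (x + e i + e j) - F' (x + e i) = A j x * S' (x + e i + e j) * S' (x + e i)"
      using v by (simp_all add: vertex_eq_def edge_diff_def lab sw)
    have "p1 \<noteq> p2"
      using cr pts FS' unfolding F' * by (auto simp: cross_ratio_quad_def)
    moreover have "p - p1 = l2 * s1 * \<sigma>" "p - p2 = l1 * s2 * \<sigma>"
      using eqs pts FS' unfolding F' S' * L by (simp_all add: algebra_simps)
    ultimately have "p1 \<noteq> p2 \<and> reach y p \<sigma> \<and> p - p1 = l2 * s1 * \<sigma> \<and> p - p2 = l1 * s2 * \<sigma>"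
      using \<open>reach y p \<sigma>\<close> by blast
    then show ?thesis by blast
  next
    case 2
    have *: "z = x + e i" "z1 = x" "z2 = x + e i + e j" "y = x + e j"
      by (simp_all add: x_def y_def z1_def z2_def 2 axis_minus_one)
    have L: "l1 = - A i x" "l2 = A j x"
      using lab by (simp_all add: signed_label_def * l1_def l2_def 2)
    note FS' = FS[unfolded *]
    note a' = a[unfolded * L] FS'
    obtain p \<sigma> F' S' where F': "F' = F(y := p)" and S': "S' = S(y := \<sigma>)" and "reach y p \<sigma>"
      and cr: "cross_ratio_quad F' A i j x"
      and v: "vertex_eq F' A S' i x" "vertex_eq F' A S' i (x + e j)"
        "vertex_eq F' A S' j x" "vertex_eq F' A S' j (x + e i)"
      by (rule fill_quad[OF assms(1), of y x F S])
        (use pts a' in \<open>auto simp: corners_def * L vertex_eq_def edge_diff_def lab sw algebra_simps\<close>)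
    have eqs: "F' (x + e i) - F' x = A i x * S' (x + e i) * S' x"
      "F' (x + e i + e j) - F' (x + e j) = A i x * S' (x + e i + e j) * S' (x + e j)"
      "F' (x + e j) - F' x = A j x * S' (x + e j) * S' x"
      "F' (x + e i + e j) - F' (x + e i) = A j x * S' (x + e i + e j) * S' (x + e i)"
      using v by (simp_all add: vertex_eq_def edge_diff_def lab sw)
    have "p1 \<noteq> p2"
      using cr pts FS' unfolding F' * by (auto simp: cross_ratio_quad_def)
    moreover have "p - p1 = l2 * s1 * \<sigma>" "p - p2 = l1 * s2 * \<sigma>"
      using eqs pts FS' unfolding F' S' * L by (simp_all add: algebra_simps)
    ultimately have "p1 \<noteq> p2 \<and> reach y p \<sigma> \<and> p - p1 = l2 * s1 * \<sigma> \<and> p - p2 = l1 * s2 * \<sigma>"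
      using \<open>reach y p \<sigma>\<close> by blast
    then show ?thesis by blast
  next
    case 3
    have *: "z = x + e j" "z1 = x + e i + e j" "z2 = x" "y = x + e i"
      by (simp_all add: x_def y_def z1_def z2_def 3 axis_minus_one)
    have L: "l1 = A i x" "l2 = - A j x"
      using lab by (simp_all add: signed_label_def * l1_def l2_def 3)
    note FS' = FS[unfolded *]
    note a' = a[unfolded * L] FS'
    obtain p \<sigma> F' S' where F': "F' = F(y := p)" and S': "S' = S(y := \<sigma>)" and "reach y p \<sigma>"
      and cr: "cross_ratio_quad F' A i j x"
      and v: "vertex_eq F' A S' i x" "vertex_eq F' A S' i (x + e j)"
        "vertex_eq F' A S' j x" "vertex_eq F' A S' j (x + e i)"
      by (rule fill_quad[OF assms(1), of y x F S])
        (use pts a' in \<open>auto simp: corners_def * L vertex_eq_def edge_diff_def lab sw algebra_simps\<close>)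
    have eqs: "F' (x + e i) - F' x = A i x * S' (x + e i) * S' x"
      "F' (x + e i + e j) - F' (x + e j) = A i x * S' (x + e i + e j) * S' (x + e j)"
      "F' (x + e j) - F' x = A j x * S' (x + e j) * S' x"
      "F' (x + e i + e j) - F' (x + e i) = A j x * S' (x + e i + e j) * S' (x + e i)"
      using v by (simp_all add: vertex_eq_def edge_diff_def lab sw)
    have "p1 \<noteq> p2"
      using cr pts FS' unfolding F' * by (auto simp: cross_ratio_quad_def)
    moreover have "p - p1 = l2 * s1 * \<sigma>" "p - p2 = l1 * s2 * \<sigma>"
      using eqs pts FS' unfolding F' S' * L by (simp_all add: algebra_simps)
    ultimately have "p1 \<noteq> p2 \<and> reach y p \<sigma> \<and> p - p1 = l2 * s1 * \<sigma> \<and> p - p2 = l1 * s2 * \<sigma>"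
      using \<open>reach y p \<sigma>\<close> by blast
    then show ?thesis by blast
  next
    case 4
    have *: "z = x + e i + e j" "z1 = x + e j" "z2 = x + e i" "y = x"
      by (simp_all add: x_def y_def z1_def z2_def 4 axis_minus_one)
    have L: "l1 = - A i x" "l2 = - A j x"
      using lab by (simp_all add: signed_label_def * l1_def l2_def 4)
    note FS' = FS[unfolded *]
    note a' = a[unfolded * L] FS'
    obtain p \<sigma> F' S' where F': "F' = F(y := p)" and S': "S' = S(y := \<sigma>)" and "reach y p \<sigma>"
      and cr: "cross_ratio_quad F' A i j x"
      and v: "vertex_eq F' A S' i x" "vertex_eq F' A S' i (x + e j)"
        "vertex_eq F' A S' j x" "vertex_eq F' A S' j (x + e i)"
      by (rule fill_quad[OF assms(1), of y x F S])
        (use pts a' in \<open>auto simp: corners_def * L vertex_eq_def edge_diff_def lab sw algebra_simps\<close>)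
    have eqs: "F' (x + e i) - F' x = A i x * S' (x + e i) * S' x"
      "F' (x + e i + e j) - F' (x + e j) = A i x * S' (x + e i + e j) * S' (x + e j)"
      "F' (x + e j) - F' x = A j x * S' (x + e j) * S' x"
      "F' (x + e i + e j) - F' (x + e i) = A j x * S' (x + e i + e j) * S' (x + e i)"
      using v by (simp_all add: vertex_eq_def edge_diff_def lab sw)
    have "p1 \<noteq> p2"
      using cr pts FS' unfolding F' * by (auto simp: cross_ratio_quad_def)
    moreover have "p - p1 = l2 * s1 * \<sigma>" "p - p2 = l1 * s2 * \<sigma>"
      using eqs pts FS' unfolding F' S' * L by (simp_all add: algebra_simps)
    ultimately have "p1 \<noteq> p2 \<and> reach y p \<sigma> \<and> p - p1 = l2 * s1 * \<sigma> \<and> p - p2 = l1 * s2 * \<sigma>"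
      using \<open>reach y p \<sigma>\<close> by blast
    then show ?thesis by blast
  qed
  then show ?thesis unfolding y_def l1_def l2_def .
qed

text \<open>Nondegeneracy yields some fourth point \<open>z\<close> completing the quad. The vertex
  equations show that the given fourth point solves the same cross-ratio equation, which is linear
  in that point, so the two coincide and distinctness is inherited.\<close>

lemma cross_ratio_quadI:
  assumes "i \<noteq> j" and r: "\<forall>w \<in> corners x i j. reach w (F w) (S w)"
    and v: "vertex_eq F A S i x" "vertex_eq F A S i (x + e j)"
      "vertex_eq F A S j x" "vertex_eq F A S j (x + e i)"
  shows "cross_ratio_quad F A i j x"
proof -
  define y where "y = x + e i + e j"
  have sw: "x + e j + e i = y" by (simp add: algebra_simps y_def)
  have lab: "A i (x + e j) = A i x" "A j (x + e i) = A j x"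
    using labelling assms(1) by (auto simp: labelling_def)
  note pts = quad_points[OF assms(1), of x] quad_points[OF assms(1)[symmetric], of x]
  note pts = pts pts[symmetric]
  obtain z where z: "cross_ratio_quad (F(y := z)) A i j x"
    using nondegenerate[OF assms(1), of y x F] r by (auto simp: corners_def y_def)
  have eq: "edge_diff F i x * edge_diff F i (x + e j) * (A j x)\<^sup>2 =
    edge_diff F j x * edge_diff F j (x + e i) * (A i x)\<^sup>2"
    using v lab sw by (simp add: vertex_eq_def y_def power2_eq_square)
  define a b where "a = (F (x + e i) - F x) * (A j x)\<^sup>2" and "b = (F (x + e j) - F x) * (A i x)\<^sup>2"
  have F: "a * (F y - F (x + e j)) = b * (F y - F (x + e i))"
    using eq unfolding edge_diff_def sw a_def b_def by (simp add: y_def mult_ac)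
  have dist: "distinct [F x, F (x + e i), z, F (x + e j)]"
    and Z: "a * (z - F (x + e j)) = b * (z - F (x + e i))"
    using z pts by (simp_all add: cross_ratio_quad_iff[OF labelling] y_def[symmetric] sw
        edge_diff_def a_def b_def mult_ac)
  \<comment> \<open>Equal leading coefficients would send the fourth point to infinity; with the
    finite solution \<open>z\<close> they would force the two middle points to coincide.\<close>
  have "a \<noteq> b"
  proof
    assume "a = b"
    moreover have "a \<noteq> 0" using dist labelling_nonzero[OF labelling] by (auto simp: a_def)
    ultimately show False using Z dist by simp
  qed
  have "(a - b) * (F y - z) = (a * (F y - F (x + e j)) - b * (F y - F (x + e i))) -
      (a * (z - F (x + e j)) - b * (z - F (x + e i)))"
    by (simp add: algebra_simps)
  also have "\<dots> = 0" using F Z by simp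
  finally have "(a - b) * (F y - z) = 0" .
  with \<open>a \<noteq> b\<close> have "F(y := z) = F" by auto
  with z show ?thesis by simp
qed

end

section \<open>The quad equation for vertex values and its consistency on a cube\<close>

lemma quad_identity:
  fixes a b :: "'a::field"
  assumes "p1 - p0 = a * s0 * s1" "p2 - p0 = b * s0 * s2" "p - p1 = b * s1 * s" "p - p2 = a * s2 * s"
  shows "s * (b * s1 - a * s2) = s0 * (b * s2 - a * s1)"
    and "p1 \<noteq> p2 \<Longrightarrow> b * s1 - a * s2 \<noteq> 0"
proof -
  \<comment> \<open>Both sides of the identity equal the diagonal from \<open>p1\<close> to
    \<open>p2\<close>, which also explains why distinct middle points make the coefficient
    nonzero.\<close>
  have 1: "s0 * (b * s2 - a * s1) = p2 - p1"
    using assms(1,2) by (simp add: algebra_simps)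
  have 2: "s * (b * s1 - a * s2) = p2 - p1"
    using assms(3,4) by (simp add: algebra_simps)
  show "s * (b * s1 - a * s2) = s0 * (b * s2 - a * s1)" using 1 2 by simp
  show "p1 \<noteq> p2 \<Longrightarrow> b * s1 - a * s2 \<noteq> 0" using 2 by auto
qed

text \<open>Up to nonzero factors, both values at the far corner of the
  cube are the quotient of \<open>K\<close> and \<open>M\<close> below, and both polynomials change sign when the directions
  \<open>i\<close> and \<open>j\<close> are interchanged.\<close>

lemma cube_consistent:
  fixes s :: "'a::field"
  assumes ij: "sij * (aj * si - ai * sj) = s * (aj * sj - ai * si)" "aj * si - ai * sj \<noteq> 0"
    and ik: "ti * (b * si - ai * t) = s * (b * t - ai * si)" "b * si - ai * t \<noteq> 0"
    and jk: "tj * (b * sj - aj * t) = s * (b * t - aj * sj)" "b * sj - aj * t \<noteq> 0"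
    and ijk: "u * (b * sij - aj * ti) = si * (b * ti - aj * sij)" "b * sij - aj * ti \<noteq> 0"
    and jik: "w * (b * sij - ai * tj) = sj * (b * tj - ai * sij)"
    and nz: "s \<noteq> 0" "si \<noteq> 0" "sj \<noteq> 0"
  shows "u = w"
proof -
  \<comment> \<open>The values \<open>s\<close>, \<open>si\<close>, \<open>sj\<close>,
    \<open>sij\<close> lie on the bottom quad, and \<open>t\<close>, \<open>ti\<close>,
    \<open>tj\<close> above the first three of them across an edge with label \<open>b\<close>. The
    last corner is \<open>u\<close> when computed on the face over the \<open>i\<close>-neighbour
    and \<open>w\<close> on the face over the \<open>j\<close>-neighbour.\<close>
  define K where "K = aj * t * si * (b\<^sup>2 - ai\<^sup>2) + ai * t * sj * (aj\<^sup>2 - b\<^sup>2) + b * si * sj * (ai\<^sup>2 - aj\<^sup>2)"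
  define D Di Dj where "D = aj * si - ai * sj" and "Di = b * si - ai * t" and "Dj = b * sj - aj * t"
  define M where "M = aj * sj * (b\<^sup>2 - ai\<^sup>2) + ai * si * (aj\<^sup>2 - b\<^sup>2) + b * t * (ai\<^sup>2 - aj\<^sup>2)"
  have d: "D \<noteq> 0" "Di \<noteq> 0" "Dj \<noteq> 0" using ij ik jk by (auto simp: D_def Di_def Dj_def)
  have sD: "sij * D = s * (aj * sj - ai * si)" and tDi: "ti * Di = s * (b * t - ai * si)"
    and tDj: "tj * Dj = s * (b * t - aj * sj)"
    using ij ik jk by (auto simp: D_def Di_def Dj_def)
  have "(b * sij - aj * ti) * (D * Di) = b * (sij * D) * Di - aj * (ti * Di) * D"
    by (simp add: algebra_simps)
  also have "\<dots> = s * si * M"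
    unfolding sD tDi unfolding M_def D_def Di_def by (simp add: algebra_simps power2_eq_square)
  finally have L1: "(b * sij - aj * ti) * (D * Di) = s * si * M" .
  have "(b * ti - aj * sij) * (D * Di) = b * (ti * Di) * D - aj * (sij * D) * Di"
    by (simp add: algebra_simps)
  also have "\<dots> = s * K"
    unfolding sD tDi unfolding K_def D_def Di_def by (simp add: algebra_simps power2_eq_square)
  finally have R1: "(b * ti - aj * sij) * (D * Di) = s * K" .
  have "(b * sij - ai * tj) * (D * Dj) = b * (sij * D) * Dj - ai * (tj * Dj) * D"
    by (simp add: algebra_simps)
  also have "\<dots> = s * sj * M"
    unfolding sD tDj unfolding M_def D_def Dj_def by (simp add: algebra_simps power2_eq_square)
  finally have L2: "(b * sij - ai * tj) * (D * Dj) = s * sj * M" .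
  have "(b * tj - ai * sij) * (D * Dj) = b * (tj * Dj) * D - ai * (sij * D) * Dj"
    by (simp add: algebra_simps)
  also have "\<dots> = s * K"
    unfolding sD tDj unfolding K_def D_def Dj_def by (simp add: algebra_simps power2_eq_square)
  finally have R2: "(b * tj - ai * sij) * (D * Dj) = s * K" .
  \<comment> \<open>\<open>M\<close> is common to the two faces at the last corner, so the
    nonvanishing coefficient on one of them settles both.\<close>
  have "M \<noteq> 0" using L1 d ijk(2) by auto
  have "(s * si) * (u * M) = (u * (b * sij - aj * ti)) * (D * Di)"
    unfolding mult.assoc[of u] L1 by (simp add: mult_ac)
  also have "\<dots> = (s * si) * K" unfolding ijk(1) using R1 by (simp add: mult_ac)
  finally have u: "u * M = K" using nz by simp
  have "(s * sj) * (w * M) = (w * (b * sij - ai * tj)) * (D * Dj)"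
    unfolding mult.assoc[of w] L2 by (simp add: mult_ac)
  also have "\<dots> = (s * sj) * K" unfolding jik using R2 by (simp add: mult_ac)
  finally have "w * M = K" using nz by simp
  with u \<open>M \<noteq> 0\<close> show ?thesis by (metis mult_right_cancel)
qed

section \<open>Transport of a solution to parallel layers\<close>

context evolution begin

text \<open>The invariant of the construction. Keeping the values reached is what allows
  nondegeneracy to be applied when the next layer is built; the cross-ratio equations are recovered
  at the end by \<open>cross_ratio_quadI\<close>.\<close>

definition good :: "(int ^ 4) set \<Rightarrow> (int ^ 4 \<Rightarrow> complex) \<Rightarrow> (int ^ 4 \<Rightarrow> complex) \<Rightarrow> bool" where
  "good \<Omega> F S \<longleftrightarrow> (\<forall>x\<in>\<Omega>. reach x (F x) (S x)) \<and>
     (\<forall>x i. x \<in> \<Omega> \<longrightarrow> x + e i \<in> \<Omega> \<longrightarrow> vertex_eq F A S i x)"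

lemma good_signed:
  assumes "good \<Omega> F S" "x \<in> \<Omega>" "x + axis i \<epsilon> \<in> \<Omega>" "\<bar>\<epsilon>\<bar> = 1"
  shows "F (x + axis i \<epsilon>) - F x = signed_label A i \<epsilon> x * S x * S (x + axis i \<epsilon>)"
proof -
  consider "\<epsilon> = 1" | "\<epsilon> = -1" using assms(4) by linarith
  then show ?thesis
  proof cases
    case 1
    have "vertex_eq F A S i x" using assms 1 by (auto simp: good_def)
    then show ?thesis by (simp add: 1 vertex_eq_def edge_diff_def signed_label_def)
  next
    case 2
    have "vertex_eq F A S i (x - e i)" using assms 2 by (auto simp: good_def axis_minus_one)
    then have "F x - F (x - e i) = A i (x - e i) * S x * S (x - e i)"
      by (simp add: vertex_eq_def edge_diff_def)
    then show ?thesis by (simp add: 2 axis_minus_one signed_label_def algebra_simps)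
  qed
qed

text \<open>An instance of \<open>section_exists\<close>. The fibre over \<open>x\<close> consists
  of the reached pairs at \<open>x + axis k \<epsilon>\<close> that satisfy the edge equation with
  \<open>x\<close>, and neighbouring fibres correspond by the edge equation in the new layer.
  \<open>fill\<close> gives existence in both directions, \<open>fourth_corner_unique\<close>
  uniqueness, and \<open>cube_consistent\<close> flatness.\<close>

lemma next_layer:
  assumes good: "good (coset v I) F S" and "k \<notin> I" "\<bar>\<epsilon>\<bar> = 1" "reach (v + axis k \<epsilon>) p \<sigma>"
    "p - F v = signed_label A k \<epsilon> v * S v * \<sigma>"
  obtains F' S' where "F' (v + axis k \<epsilon>) = p" "S' (v + axis k \<epsilon>) = \<sigma>"
    "good (coset (v + axis k \<epsilon>) I) F' S'"
    "\<And>x. x \<in> coset v I \<Longrightarrow>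
      F' (x + axis k \<epsilon>) - F x = signed_label A k \<epsilon> x * S x * S' (x + axis k \<epsilon>)"
proof -
  define l where "l = signed_label A k \<epsilon> v"
  have lx: "signed_label A k \<epsilon> x = l" if "x \<in> coset v I" for x
    unfolding l_def by (rule signed_label_cong[OF labelling])
      (use that \<open>k \<notin> I\<close> in \<open>auto simp: coset_def\<close>)
  define X where "X x = {(p, \<sigma>). reach (x + axis k \<epsilon>) p \<sigma> \<and> p - F x = l * S x * \<sigma>}" for x
  define E where "E i x P Q \<longleftrightarrow> fst Q - fst P = A i x * snd P * (snd Q :: complex)"
    for i x P Q
  have R: "reach x (F x) (S x)" "S x \<noteq> 0" if "x \<in> coset v I" for x
    using good that reach_nonzero by (auto simp: good_def)
  have edge: "F (x + axis i \<delta>) - F x = signed_label A i \<delta> x * S x * S (x + axis i \<delta>)"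
    if "x \<in> coset v I" "i \<in> I" "\<bar>\<delta>\<bar> = 1" for x i \<delta>
    using good_signed[OF good] that by simp
  \<comment> \<open>The quad spanned by \<open>i\<close> and \<open>k\<close>, with its fourth
    corner in the new layer. The sign \<delta> lets one argument serve forward and backward
    transport.\<close>
  have step: "F (x + axis i \<delta>) \<noteq> p \<and>
    (\<exists>q \<tau>. (q, \<tau>) \<in> X (x + axis i \<delta>) \<and> q - p = signed_label A i \<delta> x * \<sigma> * \<tau>)"
    if x: "x \<in> coset v I" and i: "i \<in> I" and \<delta>: "\<bar>\<delta>\<bar> = 1" and P: "(p, \<sigma>) \<in> X x" for x i \<delta> p \<sigma>
  proof -
    have "i \<noteq> k" using i \<open>k \<notin> I\<close> by auto
    have "x + axis i \<delta> \<in> coset v I" using x i by simp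
    with fill[OF \<open>i \<noteq> k\<close> \<delta> \<open>\<bar>\<epsilon>\<bar> = 1\<close> R(1)[OF x] R(1) _ edge[OF x i \<delta>]] P
    show ?thesis by (auto simp: X_def lx[OF x])
  qed
  have step1: "F (x + e i) \<noteq> p \<and> (\<exists>q \<tau>. (q, \<tau>) \<in> X (x + e i) \<and> q - p = A i x * \<sigma> * \<tau>)"
    if "x \<in> coset v I" "i \<in> I" "(p, \<sigma>) \<in> X x" for x i p \<sigma>
    using step[OF that(1,2) _ that(3), of 1] by (simp add: signed_label_def)
  have step2: "F x \<noteq> q \<and> (\<exists>p \<sigma>. (p, \<sigma>) \<in> X x \<and> p - q = - A i x * \<tau> * \<sigma>)"
    if "x \<in> coset v I" "i \<in> I" "(q, \<tau>) \<in> X (x + e i)" for x i q \<tau>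
    using step[OF _ that(2) _ that(3), of "- 1"] that by (simp add: signed_label_def axis_minus_one)
  have "\<exists>g. g v = (p, \<sigma>) \<and> (\<forall>x\<in>coset v I. g x \<in> X x \<and> (\<forall>i\<in>I. E i x (g x) (g (x + e i))))"
  proof (rule section_exists)
    show "(p, \<sigma>) \<in> X v" using assms by (simp add: X_def l_def)
  next
    fix i x a assume "i \<in> I" "x \<in> coset v I" "a \<in> X x"
    with step1[of x i "fst a" "snd a"] show "\<exists>b\<in>X (x + e i). E i x a b"
      unfolding E_def by (metis fst_conv prod.collapse snd_conv)
  next
    fix i x b assume "i \<in> I" "x \<in> coset v I" "b \<in> X (x + e i)"
    with step2[of x i "fst b" "snd b"] obtain p \<sigma> where
      "(p, \<sigma>) \<in> X x" "p - fst b = - A i x * snd b * \<sigma>" by auto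
    then show "\<exists>a\<in>X x. E i x a b"
      unfolding E_def by (intro bexI[of _ "(p, \<sigma>)"]) (auto simp: algebra_simps)
  next
    fix i x a b b' assume *: "i \<in> I" "x \<in> coset v I" "a \<in> X x" "b \<in> X (x + e i)" "b' \<in> X (x + e i)"
      "E i x a b" "E i x a b'"
    have "F (x + e i) \<noteq> fst a" using step1[of x i "fst a" "snd a"] * by auto
    with fourth_corner_unique[of "fst b" "F (x + e i)" l "S (x + e i)" "snd b" "fst a" "A i x" "snd a" "fst b'" "snd b'"] *
    show "b = b'" by (auto simp: E_def X_def prod_eq_iff)
  next
    fix i x a a' b assume *: "i \<in> I" "x \<in> coset v I" "a \<in> X x" "a' \<in> X x" "b \<in> X (x + e i)"
      "E i x a b" "E i x a' b"
    have "F x \<noteq> fst b" using step2[of x i "fst b" "snd b"] * by auto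
    with fourth_corner_unique[of "fst a" "F x" l "S x" "snd a" "fst b" "- A i x" "snd b" "fst a'" "snd a'"] *
    show "a = a'" by (auto simp: E_def X_def prod_eq_iff algebra_simps)
  next
    fix i j x a b b' c
    assume ij: "i \<in> I" "j \<in> I" "i \<noteq> j" and x: "x \<in> coset v I"
      and abc: "a \<in> X x" "b \<in> X (x + e i)" "b' \<in> X (x + e j)" "c \<in> X (x + e j + e i)"
      and E: "E i x a b" "E j x a b'" "E i (x + e j) b' c"
    have sw: "x + e j + e i = x + e i + e j" by (simp add: algebra_simps)
    have lab: "A i (x + e j) = A i x" "A j (x + e i) = A j x"
      using labelling ij by (auto simp: labelling_def)
    \<comment> \<open>The far corner of the cube reached by \<open>i\<close> and then
      \<open>j\<close>, to be compared with \<open>c\<close>, which was reached by \<open>j\<close>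
      and then \<open>i\<close>. Consistency equates the vertex values, and the common
      \<open>k\<close>-edge then equates the points.\<close>
    obtain q u where qu: "(q, u) \<in> X (x + e i + e j)" "q - fst b = A j x * snd b * u"
      using step1[of "x + e i" j "fst b" "snd b"] x ij abc lab by auto
    have e1: "F (y + e m) - F y = A m y * S y * S (y + e m)" if "y \<in> coset v I" "m \<in> I" for y m
      using edge[OF that, of 1] by (simp add: signed_label_def)
    have e4: "F (x + e i) - F x = A i x * S x * S (x + e i)"
      "F (x + e j) - F x = A j x * S x * S (x + e j)"
      "F (x + e i + e j) - F (x + e i) = A j x * S (x + e i) * S (x + e i + e j)"
      "F (x + e i + e j) - F (x + e j) = A i x * S (x + e j) * S (x + e i + e j)"
      using e1[of x i] e1[of x j] e1[of "x + e i" j] e1[of "x + e j" i] x ij lab sw by auto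
    have v5: "fst a - F x = l * S x * snd a" "fst b - F (x + e i) = l * S (x + e i) * snd b"
      "fst b' - F (x + e j) = l * S (x + e j) * snd b'"
      "fst c - F (x + e i + e j) = l * S (x + e i + e j) * snd c"
      "q - F (x + e i + e j) = l * S (x + e i + e j) * u"
      using abc qu by (auto simp: X_def sw)
    have E': "fst b - fst a = A i x * snd a * snd b" "fst b' - fst a = A j x * snd a * snd b'"
      "fst c - fst b' = A i x * snd b' * snd c"
      using E by (auto simp: E_def lab)
    have ne: "F (x + e i) \<noteq> fst a" "F (x + e j) \<noteq> fst a" "F (x + e i + e j) \<noteq> fst b"
      using step1[of x i "fst a" "snd a"] step1[of x j "fst a" "snd a"]
        step1[of "x + e i" j "fst b" "snd b"] ij abc x by auto
    have "F (x + e i) \<noteq> F (x + e j)"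
      using fill[OF ij(3), of 1 1 x "F x" "S x" "F (x + e i)" "S (x + e i)" "F (x + e j)" "S (x + e j)"]
        R x ij e4 by (auto simp: signed_label_def)
    note q = quad_identity[OF e4(1,2,3,4)] quad_identity[OF e4(1) v5(1,2) E'(1)]
      quad_identity[OF e4(2) v5(1,3) E'(2)]
      quad_identity[OF e4(3) v5(2) v5(5) qu(2)] quad_identity[OF e4(4) v5(3) v5(4) E'(3)]
    have "u = snd c"
      by (rule cube_consistent[OF q(1) q(2) q(3,4) q(5,6) q(7,8) q(9)])
        (use ne \<open>F (x + e i) \<noteq> F (x + e j)\<close> R x ij in auto)
    with v5 have "q = fst c" by (metis diff_add_cancel)
    with qu \<open>u = snd c\<close> show "E j (x + e i) b c" by (simp add: E_def lab)
  qed
  then obtain g where g: "g v = (p, \<sigma>)" "\<And>x. x \<in> coset v I \<Longrightarrow> g x \<in> X x"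
    "\<And>x i. x \<in> coset v I \<Longrightarrow> i \<in> I \<Longrightarrow> E i x (g x) (g (x + e i))" by blast
  \<comment> \<open>The section is indexed by the old layer, hence the shift back.\<close>
  define F' S' where "F' x = fst (g (x - axis k \<epsilon>))" and "S' x = snd (g (x - axis k \<epsilon>))" for x
  have shift: "x - axis k \<epsilon> \<in> coset v I" if "x \<in> coset (v + axis k \<epsilon>) I" for x
    using that by (auto simp: coset_def axis_def)
  show ?thesis
  proof (rule that[of F' S'])
    show "F' (v + axis k \<epsilon>) = p" "S' (v + axis k \<epsilon>) = \<sigma>"
      by (simp_all add: F'_def S'_def g)
    show "F' (x + axis k \<epsilon>) - F x = signed_label A k \<epsilon> x * S x * S' (x + axis k \<epsilon>)"
      if "x \<in> coset v I" for x
      using g(2)[OF that] by (auto simp: F'_def S'_def X_def lx[OF that])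
    show "good (coset (v + axis k \<epsilon>) I) F' S'"
      unfolding good_def
    proof (intro conjI ballI allI impI)
      fix x assume "x \<in> coset (v + axis k \<epsilon>) I"
      then show "reach x (F' x) (S' x)"
        using g(2)[OF shift] by (fastforce simp: F'_def S'_def X_def)
    next
      fix x i assume x: "x \<in> coset (v + axis k \<epsilon>) I" "x + e i \<in> coset (v + axis k \<epsilon>) I"
      have "i \<in> I" using x coset_step_iff by blast
      moreover from this have "i \<noteq> k" using \<open>k \<notin> I\<close> by auto
      then have "A i (x - axis k \<epsilon>) = A i x"
        by (intro labelling_cong[OF labelling]) (simp add: axis_def)
      ultimately show "vertex_eq F' A S' i x"
        using g(3)[OF shift[OF x(1)]] by (simp add: vertex_eq_def edge_diff_def F'_def S'_def E_def mult_ac diff_add_eq)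
    qed
  qed
qed

text \<open>Layers are stacked in direction \<open>k\<close>. Since \<open>a\<close> lies in
  \<open>I\<close>, the points \<open>d c\<close> and \<open>d c + e a\<close> belong to layer
  \<open>c\<close>, whereas \<open>d c + e k\<close> and \<open>d (c + 1)\<close> belong to layer
  \<open>c + 1\<close>. Thus the diagonal condition at \<open>d c\<close> hands exactly one starting
  value from either layer to the other.\<close>

lemma diagonal_extension:
  assumes good: "good (coset 0 I) F S" and "a \<in> I" "k \<notin> I" and ak: "(a, k) \<in> {(1, 3), (2, 4)}"
  obtains F' S' where "good (coset 0 (insert k I)) F' S'"
    "\<And>x. x \<in> coset 0 I \<Longrightarrow> F' x = F x \<and> S' x = S x"
    "\<And>c. S' (axis a c + axis k c + e a) * cnj (S' (axis a c + axis k c + e k)) = 1"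
proof -
  define d :: "int \<Rightarrow> int ^ 4" where "d c = axis a c + axis k c" for c
  have "a \<noteq> k" using assms by auto
  have d_net: "d c \<in> diagonal_net" for c
    using ak by (auto simp: diagonal_net_iff d_def axis_def)
  have d_coset: "coset (d c) I = coset (axis k c) I" for c
    using \<open>a \<in> I\<close> by (auto simp: coset_def d_def axis_def)
  have dS: "d (c + 1) = d c + e a + e k" for c
    by (simp add: d_def axis_add algebra_simps)
  define R where "R c \<phi> \<psi> \<longleftrightarrow> (\<forall>x\<in>coset (axis k c) I.
      fst \<psi> (x + e k) - fst \<phi> x = A k x * snd \<phi> x * snd \<psi> (x + e k)) \<and>
      snd \<phi> (d c + e a) * cnj (snd \<psi> (d c + e k)) = 1" for c and \<phi> \<psi> :: "(int ^ 4 \<Rightarrow> complex) \<times> (int ^ 4 \<Rightarrow> complex)"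
  have "\<exists>h. h 0 = (F, S) \<and> (\<forall>n. good (coset (axis k n) I) (fst (h n)) (snd (h n)) \<and> R n (h n) (h (n + 1)))"
  proof (rule int_dependent_choice)
    show "good (coset (axis k 0) I) (fst (F, S)) (snd (F, S))" using good by simp
  next
    fix n \<phi> assume "good (coset (axis k n) I) (fst \<phi>) (snd \<phi>)"
    then obtain F S where \<phi>: "\<phi> = (F, S)" and g: "good (coset (d n) I) F S"
      by (cases \<phi>) (auto simp: d_coset)
    define x where "x = d n"
    \<comment> \<open>The vertex value forced by the diagonal condition at \<open>x\<close>; the
      point \<open>p\<close> follows along the edge from \<open>x\<close>.\<close>
    define \<sigma> where "\<sigma> = 1 / cnj (S (x + e a))"
    define p where "p = F x + A k x * \<sigma> * S x"
    have xD: "x \<in> diagonal_net" by (simp add: x_def d_net)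
    have pts: "x + e a \<noteq> x + e k" "x \<noteq> x + e k"
      using \<open>a \<noteq> k\<close> by (auto simp: vec_eq_iff axis_def)
    have r: "reach x (F x) (S x)" "reach (x + e a) (F (x + e a)) (S (x + e a))"
      using g \<open>a \<in> I\<close> by (auto simp: good_def x_def)
    have "reach (x + e k) ((F(x + e k := p)) (x + e k)) ((S(x + e k := \<sigma>)) (x + e k))"
      by (rule reached.diagonal_up[where x = x and a = a and b = k and F = "F(x + e k := p)" and S = "S(x + e k := \<sigma>)"])
        (use pts r xD ak reach_nonzero[OF r(2)] in
          \<open>auto simp: \<sigma>_def p_def vertex_eq_def edge_diff_def\<close>)
    then have "reach (x + axis k 1) p \<sigma>" by simp
    from next_layer[OF g[folded x_def] \<open>k \<notin> I\<close> _ this]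
    obtain F' S' where F': "F' (x + e k) = p" "S' (x + e k) = \<sigma>" "good (coset (x + e k) I) F' S'"
      "\<And>x'. x' \<in> coset x I \<Longrightarrow> F' (x' + e k) - F x' = A k x' * S x' * S' (x' + e k)"
      by (auto simp: p_def signed_label_def mult_ac)
    have "coset (x + e k) I = coset (axis k (n + 1)) I"
      using \<open>a \<in> I\<close> by (auto simp: x_def coset_def d_def axis_def)
    moreover have "R n \<phi> (F', S')"
      using F' reach_nonzero[OF r(2)] by (auto simp: R_def \<phi> d_coset[symmetric] x_def \<sigma>_def)
    ultimately show "\<exists>\<psi>. good (coset (axis k (n + 1)) I) (fst \<psi>) (snd \<psi>) \<and> R n \<phi> \<psi>"
      using F' by (intro exI[of _ "(F', S')"]) simp
  next
    fix n \<phi> assume "good (coset (axis k (n + 1)) I) (fst \<phi>) (snd \<phi>)"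
    then obtain F S where \<phi>: "\<phi> = (F, S)" and g: "good (coset (d (n + 1)) I) F S"
      by (cases \<phi>) (auto simp: d_coset)
    define x where "x = d n"
    define y where "y = x + e a + e k"
    have y: "y = d (n + 1)" by (simp add: y_def x_def dS)
    have sw: "x + e k + e a = y" by (simp add: y_def algebra_simps)
    have lab: "A k (x + e a) = A k x"
      using labelling \<open>a \<noteq> k\<close> by (auto simp: labelling_def)
    define \<sigma> where "\<sigma> = 1 / cnj (S (x + e k))"
    define p where "p = F y - A k x * S y * \<sigma>"
    have xD: "x \<in> diagonal_net" by (simp add: x_def d_net)
    have pts: "x + e k \<noteq> x + e a" "y \<noteq> x + e a"
      using \<open>a \<noteq> k\<close> by (auto simp: y_def vec_eq_iff axis_def)
    have "x + e k \<in> coset (d (n + 1)) I"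
      using coset_diff[OF \<open>a \<in> I\<close>, of y 1 "d (n + 1)"] by (simp add: y[symmetric]) (simp add: sw[symmetric])
    then have r: "reach y (F y) (S y)" "reach (x + e k) (F (x + e k)) (S (x + e k))"
      using g by (auto simp: good_def y)
    \<comment> \<open>Downwards the roles are exchanged: the condition passes from
      \<open>x + e k\<close> to \<open>x + e a\<close>, and the point is found along the
      \<open>k\<close>-edge below the top corner \<open>y\<close>.\<close>
    have "reach (x + e a) ((F(x + e a := p)) (x + e a)) ((S(x + e a := \<sigma>)) (x + e a))"
      by (rule reached.diagonal_down[where x = x and a = k and b = a and F = "F(x + e a := p)" and S = "S(x + e a := \<sigma>)"])
        (use pts r xD ak reach_nonzero[OF r(2)] in
          \<open>auto simp: \<sigma>_def p_def vertex_eq_def edge_diff_def sw y_def[symmetric] lab\<close>)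
    then have "reach (y + axis k (- 1)) p \<sigma>" by (simp add: axis_minus_one y_def)
    moreover have "p - F y = signed_label A k (- 1) y * S y * \<sigma>"
      by (simp add: p_def signed_label_def y_def lab)
    moreover have "\<bar>- 1 :: int\<bar> = 1" by simp
    ultimately obtain F' S' where "S' (y + axis k (- 1)) = \<sigma>" "good (coset (y + axis k (- 1)) I) F' S'"
      "\<And>x'. x' \<in> coset y I \<Longrightarrow>
        F' (x' + axis k (- 1)) - F x' = signed_label A k (- 1) x' * S x' * S' (x' + axis k (- 1))"
      using next_layer[OF g[folded y] \<open>k \<notin> I\<close>] by metis
    then have F': "S' (x + e a) = \<sigma>" "good (coset (x + e a) I) F' S'"
      "\<And>x'. x' \<in> coset y I \<Longrightarrow> F' (x' - e k) - F x' = - A k (x' - e k) * S x' * S' (x' - e k)"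
      by (simp_all add: signed_label_def axis_minus_one y_def)
    have "coset (x + e a) I = coset (axis k n) I"
      using \<open>a \<in> I\<close> by (auto simp: x_def coset_def d_def axis_def)
    moreover have "R n (F', S') \<phi>"
      unfolding R_def \<phi> fst_conv snd_conv
    proof (intro conjI ballI)
      fix x' assume "x' \<in> coset (axis k n) I"
      then have "x' + e k \<in> coset y I"
        using \<open>a \<in> I\<close> by (auto simp: y coset_def d_def axis_def)
      from F'(3)[OF this] show "F (x' + e k) - F' x' = A k x' * S' x' * S (x' + e k)"
        by (simp add: algebra_simps)
    next
      show "S' (d n + e a) * cnj (S (d n + e k)) = 1"
        using F'(1) reach_nonzero[OF r(2)] by (simp add: x_def \<sigma>_def)
    qed
    ultimately show "\<exists>\<psi>. good (coset (axis k n) I) (fst \<psi>) (snd \<psi>) \<and> R n \<psi> \<phi>"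
      using F' by (intro exI[of _ "(F', S')"]) simp
  qed
  then obtain h where h0: "h 0 = (F, S)" and h: "\<And>n. good (coset (axis k n) I) (fst (h n)) (snd (h n))"
    and hR: "\<And>n. R n (h n) (h (n + 1))" by blast
  define F' S' where "F' x = fst (h (x $ k)) x" and "S' x = snd (h (x $ k)) x" for x
  have on: "x \<in> coset (axis k (x $ k)) I" if "x \<in> coset 0 (insert k I)" for x
    using that by (auto simp: coset_def axis_def)
  show ?thesis
  proof (rule that[of F' S'])
    show "good (coset 0 (insert k I)) F' S'"
      unfolding good_def
    proof (intro conjI ballI allI impI)
      fix x assume "x \<in> coset 0 (insert k I)"
      then show "reach x (F' x) (S' x)"
        using h on unfolding good_def F'_def S'_def by blast
    next
      fix x i assume x: "x \<in> coset 0 (insert k I)" "x + e i \<in> coset 0 (insert k I)"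
      then have "i \<in> insert k I" using coset_step_iff by blast
      show "vertex_eq F' A S' i x"
      proof (cases "i = k")
        case True
        with hR[of "x $ k"] on[OF x(1)] show ?thesis
          by (simp add: R_def vertex_eq_def edge_diff_def F'_def S'_def mult_ac)
      next
        case False
        then have "i \<in> I" "(x + e i) $ k = x $ k" using \<open>i \<in> insert k I\<close> by (auto simp: axis_def)
        with h[of "x $ k"] on[OF x(1)] show ?thesis
          by (simp add: good_def vertex_eq_def edge_diff_def F'_def S'_def)
      qed
    qed
  next
    fix x assume "x \<in> coset 0 I"
    then have "x $ k = 0" using \<open>k \<notin> I\<close> by (auto simp: coset_def)
    then show "F' x = F x \<and> S' x = S x" by (simp add: F'_def S'_def h0)
  next
    fix c
    have "(d c + e a) $ k = c" "(d c + e k) $ k = c + 1"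
      using \<open>a \<noteq> k\<close> by (auto simp: d_def axis_def)
    with hR[of c] show "S' (axis a c + axis k c + e a) * cnj (S' (axis a c + axis k c + e k)) = 1"
      by (simp add: R_def d_def S'_def)
  qed
qed

end

section \<open>Closure under completion of quads\<close>

text \<open>Completing quads between the two stairs gives the diagonal. Then a point at distance
  \<open>n + 2\<close> from the diagonal completes a quad whose other corners have distances
  \<open>n\<close>, \<open>n + 1\<close>, \<open>n + 1\<close>, so the induction carries two
  consecutive distances.\<close>

lemma staircase_closure:
  fixes Q :: "int \<Rightarrow> int \<Rightarrow> bool"
  assumes "Q 0 0" and stairs: "\<And>c. Q (c + 1) c" "\<And>c. Q c (c + 1)"
    and closed: "\<And>m n \<epsilon> \<delta>. \<bar>\<epsilon>\<bar> = 1 \<Longrightarrow> \<bar>\<delta>\<bar> = 1 \<Longrightarrow> Q m n \<Longrightarrow> Q (m + \<epsilon>) n \<Longrightarrow> Q m (n + \<delta>) \<Longrightarrow> Q (m + \<epsilon>) (n + \<delta>)"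
  shows "Q m n"
proof -
  have diag: "Q c c" for c
  proof (induction c rule: int_induct[of _ 0])
    case (step1 c)
    then show ?case using closed[of 1 1 c c] stairs[of c] by simp
  next
    case (step2 c)
    then show ?case using closed[of "-1" "-1" c c] stairs[of "c - 1"] by simp
  qed (rule assms)
  have "\<forall>c. (Q (c + int n) c \<and> Q c (c + int n)) \<and> (Q (c + int (Suc n)) c \<and> Q c (c + int (Suc n)))" for n
  proof (induction n)
    case 0
    then show ?case using diag stairs by simp
  next
    case (Suc n)
    have "Q (c + int (Suc (Suc n))) c" for c
      using closed[of 1 "-1" "c + 1 + int n" "c + 1"] Suc[rule_format, of "c + 1"] Suc[rule_format, of c]
      by (simp add: algebra_simps)
    moreover have "Q c (c + int (Suc (Suc n)))" for c
      using closed[of "-1" 1 "c + 1" "c + 1 + int n"] Suc[rule_format, of "c + 1"] Suc[rule_format, of c]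
      by (simp add: algebra_simps)
    ultimately show ?case using Suc by blast
  qed
  from this[of "nat \<bar>m - n\<bar>"] show ?thesis
    by (cases "m \<ge> n") (auto dest: spec[of _ n] spec[of _ m] simp: algebra_simps)
qed

text \<open>The staircases fill the coordinate planes 1, 3 and 2, 4. Every other point lies on a
  translate of the first plane through a point of the second.\<close>

lemma quad_closure:
  fixes E :: "(int ^ 4) set"
  assumes closed: "\<And>x i j \<epsilon> \<delta>. i \<noteq> j \<Longrightarrow> \<bar>\<epsilon>\<bar> = 1 \<Longrightarrow> \<bar>\<delta>\<bar> = 1 \<Longrightarrow> x \<in> E \<Longrightarrow>
      x + axis i \<epsilon> \<in> E \<Longrightarrow> x + axis j \<delta> \<in> E \<Longrightarrow> x + axis i \<epsilon> + axis j \<delta> \<in> E"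
    and "0 \<in> E"
    and stairs: "\<And>a b c. (a, b) \<in> {(1, 3), (2, 4)} \<Longrightarrow>
      axis a c + axis b c + e a \<in> E \<and> axis a c + axis b c + e b \<in> E"
  shows "x \<in> E"
proof -
  have plane: "axis a m + axis b n \<in> E" if ab: "(a, b) \<in> {(1, 3), (2, 4)}" for a b m n
  proof (rule staircase_closure[of "\<lambda>m n. axis a m + axis b n \<in> E"])
    have "a \<noteq> b" using ab by auto
    then show "axis a (m + \<epsilon>) + axis b (n + \<delta>) \<in> E"
      if "\<bar>\<epsilon>\<bar> = 1" "\<bar>\<delta>\<bar> = 1" "axis a m + axis b n \<in> E" "axis a (m + \<epsilon>) + axis b n \<in> E"
        "axis a m + axis b (n + \<delta>) \<in> E" for m n \<epsilon> \<delta>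
      using closed[of a b \<epsilon> \<delta> "axis a m + axis b n"] that by (simp add: axis_add algebra_simps)
  qed (use stairs[OF ab] \<open>0 \<in> E\<close> in \<open>auto simp: axis_add algebra_simps\<close>)
  have two: "coset 0 {a, b} \<subseteq> E" if ab: "(a, b) \<in> {(1, 3), (2, 4)}" for a b
  proof
    fix x :: "int ^ 4" assume "x \<in> coset 0 {a, b}"
    moreover have "a \<noteq> b" using ab by auto
    ultimately have "axis a (x $ a) + axis b (x $ b) = x"
      by (auto simp: coset_def vec_eq_iff axis_def)
    then show "x \<in> E" using plane[OF ab, of "x $ a" "x $ b"] by simp
  qed
  have p13: "coset 0 {1, 3} \<subseteq> E" and p24: "coset 0 {2, 4} \<subseteq> E"
    by (rule two, simp)+
  \<comment> \<open>A translated plane is filled from its single point on the 2, 4 plane, by quads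
    standing on the neighbouring filled plane.\<close>
  have move: "coset (v + axis j \<delta>) {1, 3} \<subseteq> E"
    if v: "v + axis j \<delta> \<in> E" "coset v {1, 3} \<subseteq> E" and j: "j \<in> {2, 4}" and \<delta>: "\<bar>\<delta>\<bar> = 1" for v j \<delta>
  proof
    fix y assume "y \<in> coset (v + axis j \<delta>) {1, 3}"
    then show "y \<in> E"
    proof (induction rule: coset_induct)
      case (up y i)
      have "i \<noteq> j" using up j by auto
      have "y - axis j \<delta> \<in> coset v {1, 3}" using up by (auto simp: coset_def)
      moreover from this have "y - axis j \<delta> + e i \<in> coset v {1, 3}" using up by simp
      ultimately show ?case
        using closed[OF \<open>i \<noteq> j\<close> _ \<delta>, of 1 "y - axis j \<delta>"] v(2) up.IH by (auto simp: algebra_simps)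
    next
      case (down y i)
      have "i \<noteq> j" using down j by auto
      have "y - axis j \<delta> \<in> coset v {1, 3}" using down by (auto simp: coset_def)
      moreover from this have "y + e i - axis j \<delta> \<in> coset v {1, 3}"
        using down by (auto simp: coset_def axis_def)
      ultimately show ?case
        using closed[OF \<open>i \<noteq> j\<close> _ \<delta>, of "-1" "y + e i - axis j \<delta>"] v(2) down.IH
        by (auto simp: axis_minus_one algebra_simps)
    qed (rule v)
  qed
  have "coset v {1, 3} \<subseteq> E" if "v \<in> coset 0 {2, 4}" for v
    using that
  proof (induction rule: coset_induct)
    case (up v i)
    show ?case by (rule move) (use up p24 in auto)
  next
    case (down v i)
    have "coset (v + e i + axis i (- 1)) {1, 3} \<subseteq> E"
      by (rule move) (use down p24 in \<open>auto simp: axis_minus_one\<close>)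
    then show ?case by (simp add: axis_minus_one)
  qed (rule p13)
  moreover have "x \<in> coset (axis 2 (x $ 2) + axis 4 (x $ 4)) {1, 3}"
    by (auto simp: coset_def forall_4 axis_def)
  moreover have "axis 2 (x $ 2) + axis 4 (x $ 4) \<in> coset 0 {2, 4}"
    by simp (auto simp: coset_def axis_def)
  ultimately show ?thesis by blast
qed

section \<open>Vertex values on the whole lattice, without reference to the points\<close>

definition quad_eq :: "(int ^ 'n::finite \<Rightarrow> complex) \<Rightarrow> ('n \<Rightarrow> int ^ 'n \<Rightarrow> complex) \<Rightarrow> 'n \<Rightarrow> 'n \<Rightarrow> int ^ 'n \<Rightarrow> bool"
where
  "quad_eq S A i j x \<longleftrightarrow> S (x + e i + e j) * (A j x * S (x + e i) - A i x * S (x + e j)) =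
     S x * (A j x * S (x + e j) - A i x * S (x + e i))"

locale lattice_solution =
  fixes F S :: "int ^ 4 \<Rightarrow> complex" and A :: "4 \<Rightarrow> int ^ 4 \<Rightarrow> complex"
  assumes system: "cross_ratio_system F A" and vertex: "vertex_map F A S"
begin

lemma labelling: "labelling A"
  using system by (simp add: cross_ratio_system_def)

lemma edges:
  assumes "i \<noteq> j"
  shows "F (x + e i) - F x = A i x * S x * S (x + e i)"
    "F (x + e j) - F x = A j x * S x * S (x + e j)"
    "F (x + e i + e j) - F (x + e i) = A j x * S (x + e i) * S (x + e i + e j)"
    "F (x + e i + e j) - F (x + e j) = A i x * S (x + e j) * S (x + e i + e j)"
proof -
  have sw: "x + e j + e i = x + e i + e j" by (simp add: algebra_simps)
  have lab: "A i (x + e j) = A i x" "A j (x + e i) = A j x"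
    using labelling assms by (auto simp: labelling_def)
  have step: "F (y + e m) - F y = A m y * S y * S (y + e m)" for m y
    using vertex by (simp add: vertex_map_def vertex_eq_def edge_diff_def mult_ac)
  show "F (x + e i) - F x = A i x * S x * S (x + e i)"
    "F (x + e j) - F x = A j x * S x * S (x + e j)"
    "F (x + e i + e j) - F (x + e i) = A j x * S (x + e i) * S (x + e i + e j)"
    "F (x + e i + e j) - F (x + e j) = A i x * S (x + e j) * S (x + e i + e j)"
    using step[of x i] step[of x j] step[of "x + e i" j] step[of "x + e j" i]
    by (simp_all only: lab sw)
qed

lemma points_distinct:
  assumes "i \<noteq> j"
  shows "distinct [F x, F (x + e i), F (x + e i + e j), F (x + e j)]"
  using system assms by (auto simp: cross_ratio_system_def cross_ratio_quad_def)

lemma vertex_nonzero: "S x \<noteq> 0"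
  using edges(1)[of 1 2 x] points_distinct[of 1 2 x] by auto

lemma quad_eq: "i \<noteq> j \<Longrightarrow> quad_eq S A i j x"
  unfolding quad_eq_def using edges[of i j x] by (rule quad_identity)

text \<open>The quad equation is linear in each corner value. Agreement at three corners gives
  \<open>T\<close> the same coefficients as \<open>S\<close>, and those of \<open>S\<close> are
  nonzero because its points are distinct; \<open>T\<close> itself comes with no points.\<close>

lemma agreement_closed:
  assumes T: "\<And>i j x. i \<noteq> j \<Longrightarrow> quad_eq T A i j x"
    and "i \<noteq> j" "\<bar>\<epsilon>\<bar> = 1" "\<bar>\<delta>\<bar> = 1"
    and "T z = S z" "T (z + axis i \<epsilon>) = S (z + axis i \<epsilon>)" "T (z + axis j \<delta>) = S (z + axis j \<delta>)"
  shows "T (z + axis i \<epsilon> + axis j \<delta>) = S (z + axis i \<epsilon> + axis j \<delta>)"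
proof -
  define x where "x = z - (if \<epsilon> = 1 then 0 else e i) - (if \<delta> = 1 then 0 else e j)"
  define y z1 z2 where "y = z + axis i \<epsilon> + axis j \<delta>" and "z1 = z + axis i \<epsilon>" and "z2 = z + axis j \<delta>"
  note eqs = assms(5-7)[folded z1_def z2_def]
  define a b s0 s1 s2 s t0 t1 t2 t where
    ab: "a = A i x" "b = A j x" and s: "s0 = S x" "s1 = S (x + e i)" "s2 = S (x + e j)" "s = S (x + e i + e j)"
    and t: "t0 = T x" "t1 = T (x + e i)" "t2 = T (x + e j)" "t = T (x + e i + e j)"
  note d = points_distinct[OF \<open>i \<noteq> j\<close>, of x] and ed = edges[OF \<open>i \<noteq> j\<close>, of x, folded ab s]
  have Sq: "s * (b * s1 - a * s2) = s0 * (b * s2 - a * s1)"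
    and Tq: "t * (b * t1 - a * t2) = t0 * (b * t2 - a * t1)"
    using quad_eq[OF \<open>i \<noteq> j\<close>, of x] T[OF \<open>i \<noteq> j\<close>, of x] by (simp_all add: quad_eq_def ab s t)
  \<comment> \<open>Each coefficient, times a vertex value, is a difference of opposite corners of
    the quad.\<close>
  have "s0 * (b * s2 - a * s1) = F (x + e j) - F (x + e i)" "s1 * (a * s0 + b * s) = F (x + e i + e j) - F x"
    "s2 * (b * s0 + a * s) = F (x + e i + e j) - F x"
    using ed by (simp_all add: algebra_simps)
  with d Sq have nz: "b * s1 - a * s2 \<noteq> 0" "b * s2 - a * s1 \<noteq> 0" "a * s0 + b * s \<noteq> 0" "b * s0 + a * s \<noteq> 0"
    by auto
  \<comment> \<open>The same equation regrouped around the middle corners, ready to be solved for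
    either of them.\<close>
  have Sq': "s1 * (a * s0 + b * s) = s2 * (b * s0 + a * s)" and Tq': "t1 * (a * t0 + b * t) = t2 * (b * t0 + a * t)"
    using Sq Tq by (simp_all add: algebra_simps)
  consider "\<epsilon> = 1" "\<delta> = 1" | "\<epsilon> = -1" "\<delta> = 1" | "\<epsilon> = 1" "\<delta> = -1" | "\<epsilon> = -1" "\<delta> = -1"
    using assms(3,4) by linarith
  then have "T y = S y"
  proof cases
    case 1
    have *: "z = x" "z1 = x + e i" "z2 = x + e j" "y = x + e i + e j"
      by (simp_all add: x_def y_def z1_def z2_def 1)
    note eqs[unfolded *, folded s t]
    with Sq Tq nz(1) have "t = s" by (metis mult_right_cancel)
    then show ?thesis by (simp add: * s t)
  next
    case 2
    have *: "z = x + e i" "z1 = x" "z2 = x + e i + e j" "y = x + e j"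
      by (simp_all add: x_def y_def z1_def z2_def 2 axis_minus_one)
    note eqs[unfolded *, folded s t]
    with Sq' Tq' nz(4) have "t2 = s2" by (metis mult_right_cancel)
    then show ?thesis by (simp add: * s t)
  next
    case 3
    have *: "z = x + e j" "z1 = x + e i + e j" "z2 = x" "y = x + e i"
      by (simp_all add: x_def y_def z1_def z2_def 3 axis_minus_one)
    note eqs[unfolded *, folded s t]
    with Sq' Tq' nz(3) have "t1 = s1" by (metis mult_right_cancel)
    then show ?thesis by (simp add: * s t)
  next
    case 4
    have *: "z = x + e i + e j" "z1 = x + e j" "z2 = x + e i" "y = x"
      by (simp_all add: x_def y_def z1_def z2_def 4 axis_minus_one)
    note eqs[unfolded *, folded s t]
    with Sq Tq nz(2) have "t0 = s0" by (metis mult_right_cancel)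
    then show ?thesis by (simp add: * s t)
  qed
  then show ?thesis by (simp add: y_def)
qed

end

section \<open>The symmetry and the diagonal condition\<close>

text \<open>Indices are integers modulo 4, so adding 2 swaps 1 with 3 and 2 with 4.\<close>

definition exchange :: "int ^ 4 \<Rightarrow> int ^ 4" where
  "exchange x = (\<chi> i. x $ (i + 2))"

lemma index_wrap: "(5 :: 4) = 1" "(6 :: 4) = 2"
  by simp_all

lemma add_two_two: "i + 2 + 2 = (i :: 4)"
  using exhaust_4[of i] by (auto simp: index_wrap)

lemma exchange_nth: "exchange x $ i = x $ (i + 2)"
  by (simp add: exchange_def)

lemma exchange_zero [simp]: "exchange 0 = 0"
  by (simp add: vec_eq_iff exchange_nth)

lemma exchange_add_axis: "exchange (x + axis i c) = exchange x + axis (i + 2) c"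
proof -
  have "j + 2 = i \<longleftrightarrow> j = i + 2" for j by (metis add_two_two)
  then show ?thesis by (simp add: vec_eq_iff exchange_nth axis_def)
qed

lemma exchange_diagonal: "x \<in> diagonal_net \<Longrightarrow> exchange x = x"
  by (simp add: diagonal_net_iff vec_eq_iff forall_4 exchange_nth index_wrap)

text \<open>A label depends only on the coordinate of its own direction, and \<open>exchange\<close>
  moves that coordinate along with the direction. Both labels can thus be read off at the diagonal
  point all of whose coordinates are \<open>x $ i\<close>.\<close>

lemma exchanged_label:
  assumes "labelling A" and R: "\<And>x. x \<in> diagonal_net \<Longrightarrow> R (A 1 x) (A 3 x) \<and> R (A 2 x) (A 4 x)"
    and sym: "\<And>u v. R u v \<Longrightarrow> R v u"
  shows "R (A i x) (A (i + 2) (exchange x))"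
proof -
  define y where "y = (vector [x $ i, x $ i, x $ i, x $ i] :: int ^ 4)"
  have y: "y $ j = x $ i" for j
    using exhaust_4[of j] by (auto simp: y_def)
  have "A i x = A i y" "A (i + 2) (exchange x) = A (i + 2) y"
    by (rule labelling_cong[OF assms(1)], simp add: y exchange_nth add_two_two)+
  moreover have "y \<in> diagonal_net" by (simp add: diagonal_net_iff y)
  from R[OF this] have "R (A i y) (A (i + 2) y)"
    using exhaust_4[of i] sym by (auto simp: index_wrap)
  ultimately show ?thesis by simp
qed

text \<open>Inverting the vertex map at the middle corners, or at the base and top corners, turns
  the quad equation into the one with inverted labels; inverting it at all four corners preserves
  the equation.\<close>

lemma quad_inversion:
  fixes a b :: "'a::field"
  assumes "s0 \<noteq> 0" "s1 \<noteq> 0" "s2 \<noteq> 0" "s \<noteq> 0"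
  shows "s * (b * (1 / s1) - a * (1 / s2)) = s0 * (b * (1 / s2) - a * (1 / s1)) \<longleftrightarrow>
      s * (b * s2 - a * s1) = s0 * (b * s1 - a * s2)"
    and "1 / s * (b * s1 - a * s2) = 1 / s0 * (b * s2 - a * s1) \<longleftrightarrow>
      s * (b * s2 - a * s1) = s0 * (b * s1 - a * s2)"
    and "1 / s * (b * (1 / s1) - a * (1 / s2)) = 1 / s0 * (b * (1 / s2) - a * (1 / s1)) \<longleftrightarrow>
      s * (b * s1 - a * s2) = s0 * (b * s2 - a * s1)"
proof -
  have 1: "b * (1 / s1) - a * (1 / s2) = (b * s2 - a * s1) / (s1 * s2)"
    "b * (1 / s2) - a * (1 / s1) = (b * s1 - a * s2) / (s1 * s2)"
    using assms by (simp_all add: field_simps)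
  have 2: "1 / s * u = 1 / s0 * v \<longleftrightarrow> s * v = s0 * u" for u v
    using assms by (auto simp: field_simps)
  show "1 / s * (b * s1 - a * s2) = 1 / s0 * (b * s2 - a * s1) \<longleftrightarrow>
      s * (b * s2 - a * s1) = s0 * (b * s1 - a * s2)"
    by (rule 2)
  show "s * (b * (1 / s1) - a * (1 / s2)) = s0 * (b * (1 / s2) - a * (1 / s1)) \<longleftrightarrow>
      s * (b * s2 - a * s1) = s0 * (b * s1 - a * s2)"
    unfolding 1 using assms by simp
  show "1 / s * (b * (1 / s1) - a * (1 / s2)) = 1 / s0 * (b * (1 / s2) - a * (1 / s1)) \<longleftrightarrow>
      s * (b * s1 - a * s2) = s0 * (b * s2 - a * s1)"
    unfolding 1 2 using assms by simp
qed

context lattice_solution begin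

text \<open>Near the diagonal net, \<open>T = S\<close> is precisely the diagonal condition. The
  stair hypotheses give equality on the stairs, closure under completion of quads gives it
  everywhere, and it is then read off at \<open>x\<close>.\<close>

lemma diagonal_propagation:
  assumes T: "\<And>i j x. i \<noteq> j \<Longrightarrow> quad_eq T A i j x" and T0: "T 0 = S 0"
    and T1: "\<And>x i. x \<in> diagonal_net \<Longrightarrow> T (x + e i) = 1 / cnj (S (exchange (x + e i)))"
    and stairs: "\<And>a b c. (a, b) \<in> {(1, 3), (2, 4)} \<Longrightarrow>
      S (axis a c + axis b c + e a) * cnj (S (axis a c + axis b c + e b)) = 1"
    and x: "x \<in> diagonal_net"
  shows "S (x + e 1) * cnj (S (x + e 3)) = 1 \<and> S (x + e 2) * cnj (S (x + e 4)) = 1"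
proof -
  have "y \<in> {x. T x = S x}" for y
  proof (rule quad_closure)
    fix a b :: 4 and c :: int assume ab: "(a, b) \<in> {(1, 3), (2, 4)}"
    define z where "z = axis a c + axis b c"
    have z: "z \<in> diagonal_net"
      using ab by (auto simp: diagonal_net_iff z_def axis_def)
    have sw: "exchange (z + e a) = z + e b" "exchange (z + e b) = z + e a"
      using ab by (auto simp: exchange_add_axis exchange_diagonal[OF z] index_wrap)
    have st: "S (z + e a) * cnj (S (z + e b)) = 1"
      using stairs[OF ab] by (simp add: z_def)
    \<comment> \<open>Conjugation supplies the condition with \<open>a\<close> and \<open>b\<close>
      exchanged, so that both stair points are covered.\<close>
    then have "cnj (S (z + e a) * cnj (S (z + e b))) = 1" by simp
    then have "S (z + e b) * cnj (S (z + e a)) = 1" by (simp add: mult.commute)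
    with st have "S (z + e a) = 1 / cnj (S (z + e b))" "S (z + e b) = 1 / cnj (S (z + e a))"
      using vertex_nonzero by (simp_all add: eq_divide_eq)
    moreover have "T (z + e a) = 1 / cnj (S (z + e b))" "T (z + e b) = 1 / cnj (S (z + e a))"
      using T1[OF z, of a] T1[OF z, of b] by (simp_all only: sw)
    ultimately show "axis a c + axis b c + e a \<in> {x. T x = S x} \<and> axis a c + axis b c + e b \<in> {x. T x = S x}"
      unfolding z_def[symmetric] mem_Collect_eq by argo
  qed (use agreement_closed[OF T] T0 in auto)
  then have "S (x + e i) = 1 / cnj (S (exchange (x + e i)))" for i
    using T1[OF x, of i] by auto
  from this[of 1] this[of 2] show ?thesis
    using vertex_nonzero by (simp add: exchange_add_axis exchange_diagonal[OF x] index_wrap)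
qed

lemma diagonal_conditionI:
  assumes lab: "plus_labels A \<or> minus_labels A"
    and stairs: "\<And>a b c. (a, b) \<in> {(1, 3), (2, 4)} \<Longrightarrow>
      S (axis a c + axis b c + e a) * cnj (S (axis a c + axis b c + e b)) = 1"
  shows "diagonal_condition F A"
proof -
  have S0: "S 0 = 1" using vertex by (simp add: vertex_map_def)
  define \<sigma> where "\<sigma> x = cnj (S (exchange x))" for x
  have \<sigma>nz: "\<sigma> x \<noteq> 0" for x using vertex_nonzero by (simp add: \<sigma>_def)
  \<comment> \<open>The quad equation at the exchanged point, conjugated; only its labels remain to
    be matched with those of \<open>A\<close>.\<close>
  have cq: "\<sigma> (x + e i + e j) * (cnj (A (j + 2) (exchange x)) * \<sigma> (x + e i) - cnj (A (i + 2) (exchange x)) * \<sigma> (x + e j)) =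
     \<sigma> x * (cnj (A (j + 2) (exchange x)) * \<sigma> (x + e j) - cnj (A (i + 2) (exchange x)) * \<sigma> (x + e i))"
    if "i \<noteq> j" for i j x
  proof -
    have "i + 2 \<noteq> j + 2" using that by simp
    from arg_cong[OF quad_eq[OF this, of "exchange x", unfolded quad_eq_def], of cnj]
    show ?thesis by (simp add: \<sigma>_def exchange_add_axis)
  qed
  have "\<exists>T. (\<forall>i j x. i \<noteq> j \<longrightarrow> quad_eq T A i j x) \<and> T 0 = 1 \<and>
    (\<forall>x i. x \<in> diagonal_net \<longrightarrow> T (x + e i) = 1 / \<sigma> (x + e i))"
    using lab
  proof
    assume minus: "minus_labels A"
    have A: "A i x = cnj (A (i + 2) (exchange x))" for i x
      by (rule exchanged_label[OF labelling]) (use minus in \<open>auto simp: minus_labels_def\<close>)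
    have "quad_eq (\<lambda>x. 1 / \<sigma> x) A i j x" if "i \<noteq> j" for i j x
      using cq[OF that, of x] unfolding quad_eq_def A[symmetric] quad_inversion(3)[OF \<sigma>nz \<sigma>nz \<sigma>nz \<sigma>nz] .
    then show ?thesis using S0 by (intro exI[of _ "\<lambda>x. 1 / \<sigma> x"]) (simp add: \<sigma>_def)
  next
    assume plus: "plus_labels A"
    have A: "A i x * cnj (A (i + 2) (exchange x)) = - 1" for i x
    proof (rule exchanged_label[OF labelling])
      fix u v :: complex assume "u * cnj v = - 1"
      then have "cnj (u * cnj v) = - 1" by simp
      then show "v * cnj u = - 1" by (simp add: mult.commute)
    qed (use plus in \<open>auto simp: plus_labels_def\<close>)
    \<comment> \<open>Base and top corner of a quad have equal parity and the middle corners the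
      other one, so exactly one of these pairs is inverted; this selects the first or the second
      part of \<open>quad_inversion\<close>.\<close>
    define T where "T x = (if even (\<Sum>i\<in>UNIV. x $ i) then \<sigma> x else 1 / \<sigma> x)" for x
    have parity: "(\<Sum>m\<in>UNIV. (x + e i) $ m) = (\<Sum>m\<in>UNIV. x $ m) + 1" for x :: "int ^ 4" and i
      by (simp add: sum.distrib axis_def)
    have "quad_eq T A i j x" if "i \<noteq> j" for i j x
    proof -
      define a b where "a = A i x" and "b = A j x"
      have ab: "a \<noteq> 0" "b \<noteq> 0" using labelling_nonzero[OF labelling] by (simp_all add: a_def b_def)
      have "cnj (A (i + 2) (exchange x)) = - 1 / a" "cnj (A (j + 2) (exchange x)) = - 1 / b"
        using A[of i x] A[of j x] ab by (simp_all add: a_def b_def field_simps)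
      note cq[OF that, of x, unfolded this]
      moreover have "- 1 / b * u - - 1 / a * v = (b * v - a * u) / (a * b)" for u v
        using ab by (simp add: field_simps)
      ultimately have "\<sigma> (x + e i + e j) * ((b * \<sigma> (x + e j) - a * \<sigma> (x + e i)) / (a * b)) =
         \<sigma> x * ((b * \<sigma> (x + e i) - a * \<sigma> (x + e j)) / (a * b))"
        by (simp only:)
      then have *: "\<sigma> (x + e i + e j) * (b * \<sigma> (x + e j) - a * \<sigma> (x + e i)) =
         \<sigma> x * (b * \<sigma> (x + e i) - a * \<sigma> (x + e j))"
        using ab by simp
      show ?thesis
      proof (cases "even (\<Sum>m\<in>UNIV. x $ m)")
        case True
        then have "T x = \<sigma> x" "T (x + e i) = 1 / \<sigma> (x + e i)" "T (x + e j) = 1 / \<sigma> (x + e j)"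
          "T (x + e i + e j) = \<sigma> (x + e i + e j)"
          unfolding T_def parity by simp_all
        then show ?thesis
          using * quad_inversion(1)[OF \<sigma>nz \<sigma>nz \<sigma>nz \<sigma>nz] by (simp only: quad_eq_def a_def b_def)
      next
        case False
        then have "T x = 1 / \<sigma> x" "T (x + e i) = \<sigma> (x + e i)" "T (x + e j) = \<sigma> (x + e j)"
          "T (x + e i + e j) = 1 / \<sigma> (x + e i + e j)"
          unfolding T_def parity by simp_all
        then show ?thesis
          using * quad_inversion(2)[OF \<sigma>nz \<sigma>nz \<sigma>nz \<sigma>nz] by (simp only: quad_eq_def a_def b_def)
      qed
    qed
    moreover have "T (x + e i) = 1 / \<sigma> (x + e i)" if "x \<in> diagonal_net" for x i
    proof -
      have "(\<Sum>m\<in>UNIV. x $ m) = 2 * (x $ 1 + x $ 2)"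
        using that by (simp add: diagonal_net_iff sum_4)
      then show ?thesis unfolding T_def parity by simp
    qed
    moreover have "T 0 = 1" using S0 by (simp add: T_def \<sigma>_def)
    ultimately show ?thesis by blast
  qed
  then obtain T where T: "\<forall>i j x. i \<noteq> j \<longrightarrow> quad_eq T A i j x" "T 0 = 1"
    "\<forall>x i. x \<in> diagonal_net \<longrightarrow> T (x + e i) = 1 / \<sigma> (x + e i)"
    by (elim exE conjE) (rule that)
  show ?thesis
    unfolding diagonal_condition_def
  proof (intro exI[of _ S] conjI vertex ballI)
    fix x assume x: "x \<in> diagonal_net"
    show "S (x + e 1) * cnj (S (x + e 3)) = 1" "S (x + e 2) * cnj (S (x + e 4)) = 1"
      using diagonal_propagation[of T, OF _ _ _ stairs x] T S0 by (auto simp: \<sigma>_def)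
  qed
qed

text \<open>Each rule has only one possible outcome inside a given lattice. For quads, both
  solutions satisfy the two edge equations at \<open>y\<close> over the same two distinct points;
  for the diagonal rules, the condition fixes the vertex value and an edge fixes the point. In
  particular \<open>reached\<close> is single-valued once an extension exists.\<close>

lemma reached_determined:
  assumes F: "extends_map F f" and S: "\<And>i j. S (vector [i, j, 0, 0]) = s (vector [i, j])"
    and diag: "\<And>x. x \<in> diagonal_net \<Longrightarrow>
      S (x + e 1) * cnj (S (x + e 3)) = 1 \<and> S (x + e 2) * cnj (S (x + e 4)) = 1"
    and "reached f s A y p \<sigma>"
  shows "F y = p \<and> S y = \<sigma>"
proof -
  \<comment> \<open>Conjugating the condition covers the pairs (3, 1) and (4, 2) as well.\<close>
  have diag': "cnj (S (x + e b)) = 1 / S (x + e a)"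
    if "x \<in> diagonal_net" "(a, b) \<in> {(1, 3), (3, 1), (2, 4), (4, 2)}" for x a b
  proof -
    have "cnj (S (x + e 1)) * S (x + e 3) = 1" "cnj (S (x + e 2)) * S (x + e 4) = 1"
      using diag[OF that(1), THEN conjunct1, THEN arg_cong[of _ _ cnj]]
        diag[OF that(1), THEN conjunct2, THEN arg_cong[of _ _ cnj]]
      unfolding complex_cnj_mult complex_cnj_cnj complex_cnj_one .
    with that diag[OF that(1)] show ?thesis
      using vertex_nonzero by (auto simp: field_simps)
  qed
  show ?thesis
    using assms(4)
  proof (induction rule: reached.induct)
    case (initial i j)
    then show ?case using F S by (simp add: extends_map_def)
  next
    case (quad i j y x F' S')
    have sw: "x + e j + e i = x + e i + e j" by (simp add: algebra_simps)
    have lab: "A i (x + e j) = A i x" "A j (x + e i) = A j x"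
      using labelling quad.hyps(1) by (auto simp: labelling_def)
    have agree: "F w = F' w \<and> S w = S' w" if "w \<in> corners x i j" "w \<noteq> y" for w
      using quad that by blast
    have ed': "F' (x + e i) - F' x = A i x * S' x * S' (x + e i)"
      "F' (x + e j) - F' x = A j x * S' x * S' (x + e j)"
      "F' (x + e i + e j) - F' (x + e i) = A j x * S' (x + e i) * S' (x + e i + e j)"
      "F' (x + e i + e j) - F' (x + e j) = A i x * S' (x + e j) * S' (x + e i + e j)"
      using quad.hyps by (simp_all add: vertex_eq_def edge_diff_def lab sw mult_ac)
    note ed = edges[OF quad.hyps(1), of x] and d = points_distinct[OF quad.hyps(1), of x]
    note pts = quad_points[OF quad.hyps(1), of x] quad_points[OF quad.hyps(1)[symmetric], of x]
    note pts = pts pts[symmetric]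
    consider "y = x" | "y = x + e i" | "y = x + e j" | "y = x + e i + e j"
      using quad.hyps(2) by (auto simp: corners_def)
    then show ?case
    proof cases
      case 1
      have eq: "F (x + e i) = F' (x + e i)" "S (x + e i) = S' (x + e i)" "F (x + e j) = F' (x + e j)" "S (x + e j) = S' (x + e j)"
        using agree 1 pts by (auto simp: corners_def)
      show ?thesis unfolding 1
      proof (rule fourth_corner_unique)
        show "F x - F (x + e i) = - A i x * S (x + e i) * S x" using ed(1) by (simp add: algebra_simps)
        show "F x - F (x + e j) = - A j x * S (x + e j) * S x" using ed(2) by (simp add: algebra_simps)
        show "F' x - F (x + e i) = - A i x * S (x + e i) * S' x" unfolding eq using ed'(1) by (simp add: algebra_simps)
        show "F' x - F (x + e j) = - A j x * S (x + e j) * S' x" unfolding eq using ed'(2) by (simp add: algebra_simps)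
        show "F (x + e i) \<noteq> F (x + e j)" using d by auto
      qed
    next
      case 2
      have eq: "F x = F' x" "S x = S' x" "F (x + e i + e j) = F' (x + e i + e j)" "S (x + e i + e j) = S' (x + e i + e j)"
        using agree 2 pts by (auto simp: corners_def)
      show ?thesis unfolding 2
      proof (rule fourth_corner_unique)
        show "F (x + e i) - F x = A i x * S x * S (x + e i)" using ed(1) by (simp add: algebra_simps)
        show "F (x + e i) - F (x + e i + e j) = - A j x * S (x + e i + e j) * S (x + e i)" using ed(3) by (simp add: algebra_simps)
        show "F' (x + e i) - F x = A i x * S x * S' (x + e i)" unfolding eq using ed'(1) by (simp add: algebra_simps)
        show "F' (x + e i) - F (x + e i + e j) = - A j x * S (x + e i + e j) * S' (x + e i)" unfolding eq using ed'(3) by (simp add: algebra_simps)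
        show "F x \<noteq> F (x + e i + e j)" using d by auto
      qed
    next
      case 3
      have eq: "F x = F' x" "S x = S' x" "F (x + e i + e j) = F' (x + e i + e j)" "S (x + e i + e j) = S' (x + e i + e j)"
        using agree 3 pts by (auto simp: corners_def)
      show ?thesis unfolding 3
      proof (rule fourth_corner_unique)
        show "F (x + e j) - F x = A j x * S x * S (x + e j)" using ed(2) by (simp add: algebra_simps)
        show "F (x + e j) - F (x + e i + e j) = - A i x * S (x + e i + e j) * S (x + e j)" using ed(4) by (simp add: algebra_simps)
        show "F' (x + e j) - F x = A j x * S x * S' (x + e j)" unfolding eq using ed'(2) by (simp add: algebra_simps)
        show "F' (x + e j) - F (x + e i + e j) = - A i x * S (x + e i + e j) * S' (x + e j)" unfolding eq using ed'(4) by (simp add: algebra_simps)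
        show "F x \<noteq> F (x + e i + e j)" using d by auto
      qed
    next
      case 4
      have eq: "F (x + e i) = F' (x + e i)" "S (x + e i) = S' (x + e i)" "F (x + e j) = F' (x + e j)" "S (x + e j) = S' (x + e j)"
        using agree 4 pts by (auto simp: corners_def)
      show ?thesis unfolding 4
      proof (rule fourth_corner_unique)
        show "F (x + e i + e j) - F (x + e i) = A j x * S (x + e i) * S (x + e i + e j)" using ed(3) by (simp add: algebra_simps)
        show "F (x + e i + e j) - F (x + e j) = A i x * S (x + e j) * S (x + e i + e j)" using ed(4) by (simp add: algebra_simps)
        show "F' (x + e i + e j) - F (x + e i) = A j x * S (x + e i) * S' (x + e i + e j)" unfolding eq using ed'(3) by (simp add: algebra_simps)
        show "F' (x + e i + e j) - F (x + e j) = A i x * S (x + e j) * S' (x + e i + e j)" unfolding eq using ed'(4) by (simp add: algebra_simps)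
        show "F (x + e i) \<noteq> F (x + e j)" using d by auto
      qed
    qed
  next
    case (diagonal_up x a b F' S')
    have "S (x + e a) = S' (x + e a)" using diagonal_up by blast
    moreover from this have "cnj (S' (x + e b)) = 1 / S' (x + e a)"
      using diagonal_up vertex_nonzero[of "x + e a"] by (simp add: eq_divide_eq mult.commute)
    ultimately have "cnj (S (x + e b)) = cnj (S' (x + e b))"
      using diag'[OF diagonal_up.hyps(1,2)] by simp
    then have Sb: "S (x + e b) = S' (x + e b)" by simp
    have "F (x + e b) - F x = A b x * S (x + e b) * S x"
      using vertex by (auto simp: vertex_map_def vertex_eq_def edge_diff_def)
    with diagonal_up Sb show ?case by (auto simp: vertex_eq_def edge_diff_def algebra_simps)
  next
    case (diagonal_down x a b F' S')
    have "S (x + e a) = S' (x + e a)" using diagonal_down by blast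
    moreover from this have "cnj (S' (x + e b)) = 1 / S' (x + e a)"
      using diagonal_down vertex_nonzero[of "x + e a"] by (simp add: eq_divide_eq mult.commute)
    ultimately have "cnj (S (x + e b)) = cnj (S' (x + e b))"
      using diag'[OF diagonal_down.hyps(1,2)] by simp
    then have Sb: "S (x + e b) = S' (x + e b)" by simp
    have sw: "x + e b + e a = x + e a + e b" by (simp add: algebra_simps)
    have "F (x + e a + e b) - F (x + e b) = A a (x + e b) * S (x + e a + e b) * S (x + e b)"
      using vertex by (auto simp: vertex_map_def vertex_eq_def edge_diff_def sw[symmetric])
    with diagonal_down Sb show ?case by (auto simp: vertex_eq_def edge_diff_def sw algebra_simps)
  qed
qed

end

section \<open>Existence and uniqueness of the lattices\<close>

lemma two_vector: "vector [x $ 1, x $ 2] = (x :: int ^ 2)"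
  by (simp add: vec_eq_iff forall_2)

lemma edge_diff_nonzero:
  fixes f :: "int ^ 2 \<Rightarrow> complex"
  assumes "cross_ratio_system f \<alpha>"
  shows "edge_diff f i x \<noteq> 0"
proof -
  obtain j :: 2 where "i \<noteq> j" by (metis (full_types) exhaust_2 one_neq_zero zero_neq_one)
  with assms have "cross_ratio_quad f \<alpha> i j x" by (simp add: cross_ratio_system_def)
  then show ?thesis by (auto simp: cross_ratio_quad_def edge_diff_def)
qed

text \<open>Transport of nonzero numbers along edges: given one end value, the edge equation
  determines the other by division. The cross-ratio equation says, through
  \<open>fourth_edge\<close>, that this transport is flat.\<close>

lemma vertex_map_exists:
  fixes f :: "int ^ 2 \<Rightarrow> complex"
  assumes f: "cross_ratio_system f \<alpha>"
  shows "\<exists>s. vertex_map f \<alpha> s"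
proof -
  have lab: "labelling \<alpha>" using f by (simp add: cross_ratio_system_def)
  note nz = labelling_nonzero[OF lab] edge_diff_nonzero[OF f]
  have "\<exists>g. g 0 = 1 \<and> (\<forall>x\<in>coset 0 UNIV. g x \<in> - {0} \<and>
      (\<forall>i\<in>UNIV. edge_diff f i x = \<alpha> i x * g x * g (x + e i)))"
  proof (rule section_exists[where E = "\<lambda>i x a b. edge_diff f i x = \<alpha> i x * a * b"])
    fix i x a assume "a \<in> - {0 :: complex}"
    then show "\<exists>b\<in>- {0}. edge_diff f i x = \<alpha> i x * a * b"
      using nz by (intro bexI[of _ "edge_diff f i x / (\<alpha> i x * a)"]) auto
  next
    fix i x b assume "b \<in> - {0 :: complex}"
    then show "\<exists>a\<in>- {0}. edge_diff f i x = \<alpha> i x * a * b"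
      using nz by (intro bexI[of _ "edge_diff f i x / (\<alpha> i x * b)"]) auto
  next
    fix i j :: 2 and x :: "int ^ 2" and a b b' c :: complex
    assume "i \<noteq> j" and abc: "a \<in> - {0}" "b \<in> - {0}" "b' \<in> - {0}" "c \<in> - {0}"
      and ev: "edge_diff f i x = \<alpha> i x * a * b" "edge_diff f j x = \<alpha> j x * a * b'"
        "edge_diff f i (x + e j) = \<alpha> i (x + e j) * b' * c"
    have "cross_ratio_quad f \<alpha> i j x" using f \<open>i \<noteq> j\<close> by (simp add: cross_ratio_system_def)
    then have cr: "edge_diff f j x * edge_diff f j (x + e i) * (\<alpha> i x)\<^sup>2 =
      edge_diff f i x * edge_diff f i (x + e j) * (\<alpha> j x)\<^sup>2"
      by (simp add: cross_ratio_quad_iff[OF lab])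
    have l: "\<alpha> i (x + e j) = \<alpha> i x" "\<alpha> j (x + e i) = \<alpha> j x"
      using lab \<open>i \<noteq> j\<close> by (auto simp: labelling_def)
    show "edge_diff f j (x + e i) = \<alpha> j (x + e i) * b * c"
      unfolding l by (rule fourth_edge[OF cr ev(2,1) ev(3)[unfolded l]]) (use nz abc in auto)
  qed (use nz in auto)
  then obtain g where "g 0 = 1" "\<And>i x. edge_diff f i x = \<alpha> i x * g x * g (x + e i)"
    by (auto simp: coset_def)
  then show ?thesis
    by (intro exI[of _ g]) (simp add: vertex_map_def vertex_eq_def mult_ac)
qed

lemma vertex_map_nonzero:
  fixes f :: "int ^ 2 \<Rightarrow> complex"
  assumes "cross_ratio_system f \<alpha>" "vertex_map f \<alpha> s"
  shows "s x \<noteq> 0"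
  using edge_diff_nonzero[OF assms(1), of 1 x] assms(2) by (auto simp: vertex_map_def vertex_eq_def)

lemma vertex_map_unique:
  fixes f :: "int ^ 2 \<Rightarrow> complex"
  assumes f: "cross_ratio_system f \<alpha>" and s: "vertex_map f \<alpha> s" and t: "vertex_map f \<alpha> t"
  shows "s x = t x"
proof -
  have eq: "s (x + e i) * s x = t (x + e i) * t x" for x i
    using s t labelling_nonzero[of \<alpha> i x] f
    by (auto simp: vertex_map_def vertex_eq_def cross_ratio_system_def mult.assoc)
  have "x \<in> coset 0 UNIV" by (simp add: coset_def)
  then show ?thesis
  proof (induction rule: coset_induct)
    case base
    show ?case using s t by (simp add: vertex_map_def)
  next
    case (up x i)
    with eq[where x = x and i = i] vertex_map_nonzero[OF f t] show ?case by simp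
  next
    case (down x i)
    with eq[where x = x and i = i] vertex_map_nonzero[OF f t] show ?case by simp
  qed
qed

text \<open>Both label conditions prescribe directions 3 and 4 from 1 and 2 by a function
  \<open>h\<close>, namely \<open>cnj\<close> or -1 / \<open>cnj\<close>. Existence and uniqueness
  of the labels can thus be treated once.\<close>

definition diagonal_labels :: "(complex \<Rightarrow> complex) \<Rightarrow> (4 \<Rightarrow> int ^ 4 \<Rightarrow> complex) \<Rightarrow> bool" where
  "diagonal_labels h A \<longleftrightarrow> (\<forall>x\<in>diagonal_net. A 3 x = h (A 1 x) \<and> A 4 x = h (A 2 x))"

lemma minus_labels_iff: "minus_labels A \<longleftrightarrow> diagonal_labels cnj A"
  by (auto simp: minus_labels_def diagonal_labels_def)

lemma plus_labels_iff:
  assumes "labelling A"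
  shows "plus_labels A \<longleftrightarrow> diagonal_labels (\<lambda>z. - 1 / cnj z) A"
proof -
  have "u * cnj v = - 1 \<longleftrightarrow> v = - 1 / cnj u" if "u \<noteq> 0" for u v :: complex
  proof -
    have "u * cnj v = - 1 \<longleftrightarrow> cnj (u * cnj v) = cnj (- 1)" by (simp only: complex_cnj_cancel_iff)
    also have "\<dots> \<longleftrightarrow> v = - 1 / cnj u" using that by (simp add: nonzero_eq_divide_eq mult.commute del: minus_divide_left divide_minus_left)
    finally show ?thesis .
  qed
  from this[OF labelling_nonzero[OF assms]] show ?thesis
    by (simp only: plus_labels_def diagonal_labels_def)
qed

lemma extended_labels_unique:
  assumes "labelling A" "extends_labels A \<alpha>" "diagonal_labels h A"
    and "labelling B" "extends_labels B \<alpha>" "diagonal_labels h B"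
  shows "A = B"
proof (intro ext)
  fix i :: 4 and x :: "int ^ 4"
  define y where "y = (vector [x $ i, x $ i, 0, 0] :: int ^ 4)"
  define z where "z = (vector [x $ i, x $ i, x $ i, x $ i] :: int ^ 4)"
  have yz: "y $ 1 = x $ i" "y $ 2 = x $ i" "z $ j = x $ i" for j
    using exhaust_4[of j] by (auto simp: y_def z_def)
  have y: "A 1 y = B 1 y" "A 2 y = B 2 y"
    using assms(2,5) unfolding extends_labels_def y_def by simp_all
  have "A 1 z = B 1 z" "A 2 z = B 2 z"
    using y labelling_cong[OF assms(1), of y _ z] labelling_cong[OF assms(4), of y _ z] by (auto simp: yz)
  moreover have "z \<in> diagonal_net" by (simp add: diagonal_net_iff yz)
  ultimately have "A i z = B i z"
    using assms(3,6) exhaust_4[of i] by (auto simp: diagonal_labels_def)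
  then show "A i x = B i x"
    using labelling_cong[OF assms(1), of z i x] labelling_cong[OF assms(4), of z i x] by (simp add: yz)
qed

lemma extended_labels_exist:
  fixes \<alpha> :: "2 \<Rightarrow> int ^ 2 \<Rightarrow> complex"
  assumes \<alpha>: "labelling \<alpha>" and h: "\<And>z. z \<noteq> 0 \<Longrightarrow> h z \<noteq> 0"
  shows "\<exists>A. labelling A \<and> extends_labels A \<alpha> \<and> diagonal_labels h A"
proof -
  \<comment> \<open>Each label depends on one coordinate only, so evaluating \<alpha> at the point
    with that coordinate repeated loses nothing.\<close>
  define A :: "4 \<Rightarrow> int ^ 4 \<Rightarrow> complex" where
    "A i x = (let c = vector [x $ i, x $ i] in
      if i = 1 then \<alpha> 1 c else if i = 2 then \<alpha> 2 c else if i = 3 then h (\<alpha> 1 c) else h (\<alpha> 2 c))"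
    for i x
  have "labelling A"
    using labelling_nonzero[OF \<alpha>] h by (auto simp: labelling_def A_def Let_def axis_def)
  moreover have "extends_labels A \<alpha>"
    unfolding extends_labels_def
  proof (intro allI)
    fix i j
    show "A 1 (vector [i, j, 0, 0]) = \<alpha> 1 (vector [i, j]) \<and> A 2 (vector [i, j, 0, 0]) = \<alpha> 2 (vector [i, j])"
      using labelling_cong[OF \<alpha>, of "vector [i, i]" 1 "vector [i, j]"]
        labelling_cong[OF \<alpha>, of "vector [j, j]" 2 "vector [i, j]"]
      by (simp add: A_def Let_def)
  qed
  moreover have "diagonal_labels h A"
    by (auto simp: diagonal_labels_def A_def diagonal_net_iff Let_def)
  ultimately show ?thesis by blast
qed

section \<open>The global lattice and its uniqueness\<close>

lemma (in evolution) global_solution: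
  assumes \<alpha>: "extends_labels A \<alpha>" and s: "vertex_map f \<alpha> s" and lab: "plus_labels A \<or> minus_labels A"
  obtains F S where "cross_ratio_system F A" "vertex_map F A S" "diagonal_condition F A" "extends_map F f"
    "\<And>x. reach x (F x) (S x)"
proof -
  define F0 S0 where "F0 x = f (vector [x $ 1, x $ 2])" and "S0 x = s (vector [x $ 1, x $ 2])"
    for x :: "int ^ 4"
  have plane: "x = vector [x $ 1, x $ 2, 0, 0]" if "x \<in> coset 0 {1, 2}" for x :: "int ^ 4"
    using that by (auto simp: coset_def vec_eq_iff forall_4)
  have "good (coset 0 {1, 2}) F0 S0"
    unfolding good_def
  proof (intro conjI ballI allI impI)
    fix x :: "int ^ 4" assume x: "x \<in> coset 0 {1, 2}"
    show "reach x (F0 x) (S0 x)"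
      by (subst plane[OF x]) (unfold F0_def S0_def, rule reached.initial)
    fix i :: 4 assume "x + e i \<in> coset 0 {1, 2}"
    with x have "i \<in> {1, 2}" using coset_step_iff by blast
    then have "\<exists>m. vector [(x + e i) $ 1, (x + e i) $ 2] = vector [x $ 1, x $ 2] + (e m :: int ^ 2) \<and>
        A i x = \<alpha> m (vector [x $ 1, x $ 2])"
    proof (elim insertE emptyE)
      assume "i = 1"
      have "A 1 x = \<alpha> 1 (vector [x $ 1, x $ 2])"
        using \<alpha> plane[OF x] unfolding extends_labels_def by metis
      then show ?thesis using \<open>i = 1\<close>
        by (intro exI[of _ 1]) (simp add: vec_eq_iff forall_2 axis_def)
    next
      assume "i = 2"
      have "A 2 x = \<alpha> 2 (vector [x $ 1, x $ 2])"
        using \<alpha> plane[OF x] unfolding extends_labels_def by metis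
      then show ?thesis using \<open>i = 2\<close>
        by (intro exI[of _ 2]) (simp add: vec_eq_iff forall_2 axis_def)
    qed
    then show "vertex_eq F0 A S0 i x"
      using s by (auto simp: vertex_map_def vertex_eq_def edge_diff_def F0_def S0_def)
  qed
  then obtain F1 S1 where 1: "good (coset 0 (insert 3 {1, 2})) F1 S1"
    "\<And>x. x \<in> coset 0 {1, 2} \<Longrightarrow> F1 x = F0 x \<and> S1 x = S0 x"
    "\<And>c. S1 (axis 1 c + axis 3 c + e 1) * cnj (S1 (axis 1 c + axis 3 c + e 3)) = 1"
    by (rule diagonal_extension[where a = 1 and k = 3]) (simp, simp, simp, blast)
  obtain F S where 2: "good (coset 0 (insert 4 (insert 3 {1, 2}))) F S"
    "\<And>x. x \<in> coset 0 (insert 3 {1, 2}) \<Longrightarrow> F x = F1 x \<and> S x = S1 x"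
    "\<And>c. S (axis 2 c + axis 4 c + e 2) * cnj (S (axis 2 c + axis 4 c + e 4)) = 1"
    by (rule diagonal_extension[OF 1(1), where a = 2 and k = 4]) (simp, simp, simp, blast)
  have "coset (0 :: int ^ 4) (insert 4 (insert 3 {1, 2})) = UNIV"
    using exhaust_4 by (fastforce simp: coset_def)
  with 2(1) have R: "\<And>x. reach x (F x) (S x)" and V: "\<And>x i. vertex_eq F A S i x"
    by (auto simp: good_def)
  have base: "F x = F0 x \<and> S x = S0 x" if "x \<in> coset 0 {1, 2}" for x
    using 1(2)[OF that] 2(2)[of x] that by (auto simp: coset_def)
  have system: "cross_ratio_system F A"
    unfolding cross_ratio_system_def using labelling cross_ratio_quadI R V by blast
  have "S 0 = 1"
    using base[of 0] s two_vector[of 0] by (simp add: S0_def vertex_map_def)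
  then have vertex: "vertex_map F A S" using V by (simp add: vertex_map_def)
  interpret lattice_solution F S A using system vertex by unfold_locales
  have "diagonal_condition F A"
  proof (rule diagonal_conditionI[OF lab])
    fix a b :: 4 and c :: int assume ab: "(a, b) \<in> {(1, 3), (2, 4)}"
    \<comment> \<open>The conditions in the 1, 3 plane were arranged before direction 4 was added;
      they persist because \<open>S\<close> extends \<open>S1\<close>.\<close>
    have "axis 1 c + axis 3 c + e m \<in> coset 0 (insert 3 {1, 2})" if "m \<in> {1, 3}" for m :: 4
      using that by (auto simp: coset_def axis_def)
    from 2(2)[OF this[of 1]] 2(2)[OF this[of 3]] have "S (axis 1 c + axis 3 c + e 1) = S1 (axis 1 c + axis 3 c + e 1)"
      "S (axis 1 c + axis 3 c + e 3) = S1 (axis 1 c + axis 3 c + e 3)"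
      using 2(2) by simp_all
    with ab 1(3)[of c] 2(3)[of c] show "S (axis a c + axis b c + e a) * cnj (S (axis a c + axis b c + e b)) = 1"
      by auto
  qed
  moreover have "extends_map F f"
    unfolding extends_map_def
  proof (intro allI)
    fix i j
    have "vector [i, j, 0, 0] \<in> coset (0 :: int ^ 4) {1, 2}"
      by (auto simp: coset_def forall_4)
    from base[OF this] show "F (vector [i, j, 0, 0]) = f (vector [i, j])" by (simp add: F0_def)
  qed
  ultimately show ?thesis using that system vertex R by blast
qed

lemma unique_lattice:
  fixes f :: "int ^ 2 \<Rightarrow> complex" and \<alpha> :: "2 \<Rightarrow> int ^ 2 \<Rightarrow> complex"
  assumes f: "cross_ratio_system f \<alpha>" and P: "P = plus_labels \<or> P = minus_labels"
    and nondeg: "nondegenerate_evolution P f \<alpha>"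
  shows "\<exists>!(F, A). (cross_ratio_system F A \<and> diagonal_condition F A \<and> P A) \<and>
    extends_map F f \<and> extends_labels A \<alpha>" (is "Ex1 ?Q")
proof -
  obtain h where h: "\<And>A. labelling A \<Longrightarrow> P A \<longleftrightarrow> diagonal_labels h A" "\<And>z. z \<noteq> 0 \<Longrightarrow> h z \<noteq> 0"
    using P
  proof
    assume P: "P = plus_labels"
    show ?thesis
      by (rule that[of "\<lambda>z. - 1 / cnj z"]) (simp_all only: P plus_labels_iff, simp)
  next
    assume P: "P = minus_labels"
    show ?thesis
      by (rule that[of cnj]) (simp_all only: P minus_labels_iff, simp)
  qed
  obtain s where s: "vertex_map f \<alpha> s" using vertex_map_exists[OF f] by blast
  have "labelling \<alpha>" using f by (simp add: cross_ratio_system_def)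
  from extended_labels_exist[OF this, of h] h(2)
  obtain A where A': "labelling A" "extends_labels A \<alpha>" "diagonal_labels h A" by metis
  then have "P A" using h(1) by simp
  note A = A'(1,2) this
  interpret evolution f s A
  proof
    fix i j x y F
    assume "i \<noteq> j" "y \<in> corners x i j" "\<forall>w\<in>corners x i j - {y}. \<exists>\<sigma>. reached f s A w (F w) \<sigma>"
    then have prem: "i \<noteq> j \<and> y \<in> corners x i j \<and> (\<forall>w\<in>corners x i j - {y}. \<exists>\<sigma>. reached f s A w (F w) \<sigma>)"
      by (intro conjI)
    have "vertex_map f \<alpha> s \<and> labelling A \<and> extends_labels A \<alpha> \<and> P A"
      using s A by (intro conjI)
    from nondeg[unfolded nondegenerate_evolution_def, THEN spec, THEN spec, THEN mp, OF this,
        THEN spec, THEN spec, THEN spec, THEN spec, THEN spec, THEN mp, OF prem]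
    show "\<exists>z. cross_ratio_quad (F(y := z)) A i j x" .
  qed (use A(1) vertex_map_nonzero[OF f s] in auto)
  have "plus_labels A \<or> minus_labels A" using P A by auto
  then obtain F S where F: "cross_ratio_system F A" "diagonal_condition F A" "extends_map F f"
    and R: "\<And>x. reach x (F x) (S x)"
    using global_solution[OF A(2) s] by metis
  have unique: "G = F \<and> B = A" if G: "cross_ratio_system G B" "diagonal_condition G B" "P B"
    "extends_map G f" "extends_labels B \<alpha>" for G B
  proof -
    have "labelling B" using G by (simp add: cross_ratio_system_def)
    then have "diagonal_labels h B" using h(1) G(3) by simp
    moreover have "diagonal_labels h A" using h(1) A by simp
    ultimately have "B = A"
      using \<open>labelling B\<close> G(5) A(1,2) by (intro extended_labels_unique)
    obtain T where T: "vertex_map G A T" and diag: "\<And>x. x \<in> diagonal_net \<Longrightarrow>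
        T (x + e 1) * cnj (T (x + e 3)) = 1 \<and> T (x + e 2) * cnj (T (x + e 4)) = 1"
      using G(2) unfolding \<open>B = A\<close> diagonal_condition_def by metis
    interpret L: lattice_solution G T A
      using G(1) T unfolding \<open>B = A\<close> by unfold_locales
    \<comment> \<open>The evolution starts from \<open>s\<close>, so a competing lattice can be
      compared with it only after its vertex map, restricted to the initial plane, is identified
      with \<open>s\<close> by \<open>vertex_map_unique\<close>.\<close>
    define t where "t x = T (vector [x $ 1, x $ 2, 0, 0])" for x :: "int ^ 2"
    have "vertex_map f \<alpha> t"
      unfolding vertex_map_def
    proof (intro conjI allI)
      have "(vector [0, 0, 0, 0] :: int ^ 4) = 0" by (simp add: vec_eq_iff forall_4)
      then show "t 0 = 1" using T by (simp add: t_def vertex_map_def)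
      fix i :: 2 and x :: "int ^ 2"
      define m :: 4 where "m = (if i = 1 then 1 else 2)"
      define y where "y = (vector [x $ 1, x $ 2, 0, 0] :: int ^ 4)"
      have fG: "f z = G (vector [z $ 1, z $ 2, 0, 0])" for z
        using G(4) two_vector[of z] unfolding extends_map_def by metis
      have \<alpha>A: "\<alpha> 1 x = A 1 y" "\<alpha> 2 x = A 2 y"
        using A(2) two_vector[of x] unfolding extends_labels_def y_def by metis+
      have i: "i = 1 \<or> i = 2" by (rule exhaust_2)
      then have "(vector [(x + e i) $ 1, (x + e i) $ 2, 0, 0] :: int ^ 4) = y + e m"
        by (auto simp: m_def y_def vec_eq_iff forall_4 axis_def)
      moreover have "\<alpha> i x = A m y" using i \<alpha>A by (auto simp: m_def)
      moreover have "vertex_eq G A T m y" using T by (simp add: vertex_map_def)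
      ultimately show "vertex_eq f \<alpha> t i x"
        unfolding vertex_eq_def edge_diff_def t_def fG by (simp add: y_def)
    qed
    then have "T (vector [i, j, 0, 0]) = s (vector [i, j])" for i j
      using vertex_map_unique[OF f s, of t "vector [i, j]"] by (simp add: t_def)
    then have "G x = F x" for x
      by (rule L.reached_determined[OF G(4) _ diag R, THEN conjunct1])
    then have "G = F" by (rule ext)
    then show ?thesis using \<open>B = A\<close> ..
  qed
  show ?thesis
  proof (rule ex1I[of _ "(F, A)"])
    show "?Q (F, A)" using F A by simp
    fix GB assume "?Q GB"
    then show "GB = (F, A)"
      using unique[of "fst GB" "snd GB"] by (cases GB) simp
  qed
qed

theorem proposition4p6:
  fixes f :: "int ^ 2 \<Rightarrow> complex" and \<alpha> :: "2 \<Rightarrow> int ^ 2 \<Rightarrow> complex"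
  assumes "cross_ratio_system f \<alpha>"
  shows "(nondegenerate_evolution plus_labels f \<alpha> \<longrightarrow>
            (\<exists>!(F, A). C_plus_lattice F A \<and> extends_map F f \<and> extends_labels A \<alpha>)) \<and>
         (nondegenerate_evolution minus_labels f \<alpha> \<longrightarrow>
            (\<exists>!(F, A). C_minus_lattice F A \<and> extends_map F f \<and> extends_labels A \<alpha>))"
  unfolding C_plus_lattice_def C_minus_lattice_def
  using unique_lattice[OF assms, of plus_labels] unique_lattice[OF assms, of minus_labels] by simp

end
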